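(* Let $q=x_0^2+x_1^2+x_2^2+x_3^2$ and $\tau=\frac12(1+\sqrt5)$. (a) For all even integers $n,m\ge 4$, the space $\mathbb{C}[x_0,x_1,x_2,x_3]^{D_nD_m}_4$ has dimension two and is generated by $q^2$ and $f_2+f_3$, where $f_2=2(x_0^2x_2^2+x_1^2x_3^2)$ and $f_3=2(x_0^2x_3^2+x_1^2x_2^2)$. (b) For all even integers $n\ge 6$, the spaces $\mathbb{C}[x_0,x_1,x_2,x_3]^{TD_n}_8$ and $\mathbb{C}[x_0,x_1,x_2,x_3]^{OD_n}_8$ have dimension two and are both generated by $q^4$ and $P_8=\prod_{i=0}^{3}K_i$, where $$K_i=x_0^2+x_1^2-x_2^2-x_3^2+(-1)^i2x_0(x_2+x_3)+2x_1(x_2-x_3)\quad\text{for } i=0,3,$$ $$K_i=x_0^2+x_1^2-x_2^2-x_3^2+(-1)^i2x_0(x_2+x_3)-2x_1(x_2-x_3)\quad\text{for } i=1,2.$$ (c) For all even integers $n\ge 8$, the space $\mathbb{C}[x_0,x_1,x_2,x_3]^{ID_n}_{12}$ has dimension two and is generated by $q^6$ and $P_{12}=\prod_{i=0}^5K_i'$, where $$K_0'=x_0^2+x_1^2-x_2^2-x_3^2+2(1-\tau)(x_0x_2-x_1x_3),$$ $$K_1'=x_0^2+x_1^2-x_2^2-x_3^2+2\tau(x_0x_3+x_1x_2),$$ $$K_2'=x_0^2+x_1^2-x_2^2-x_3^2-2(1-\tau)(x_0x_2-x_1x_3),$$ $$K_3'=x_0^2+x_1^2-x_2^2-x_3^2-2\tau(x_0x_3+x_1x_2),$$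 $$K_4'=2(1-\tau)(x_0x_3+x_1x_2)+2(x_0x_2-x_1x_3),$$ $$K_5'=-2\tau(x_0x_3+x_1x_2)+2(x_0x_2-x_1x_3).$$
   Context: Identify $\mathbb{R}^4$ with the quaternions via $(x_0,x_1,x_2,x_3)\leftrightarrow x_0+x_1 i+x_2 j+x_3 k$. A pair $(g_1,g_2)$ of unit quaternions acts on $\mathbb{R}^4$ by $p\mapsto g_1\,p\,g_2^{-1}$; this gives the double covering $SU(2)\times SU(2)\to SO(4)$. $SO(4)$ acts on $\mathbb{C}[x_0,x_1,x_2,x_3]$ by linear substitution, and $\mathbb{C}[x_0,x_1,x_2,x_3]_j^G$ denotes the space of $G$-invariant homogeneous polynomials of degree $j$. Put $\tilde S=\frac12(1+i-j+k)$, $\tilde U=\frac12(\tau+(\tau-1)j+k)$, $\tilde R_n=\cos\frac{\pi}{n}+\sin\frac{\pi}{n}\,i$. Let $\tilde D_n=\langle j,\tilde R_n\rangle$ (binary dihedral group, order $4n$), $\tilde T=\langle i,\tilde S\rangle$, $\tilde O=\langle i,\tilde R_4,\tilde S\rangle$, $\tilde I=\langle i,\tilde S,\tilde U\rangle$ (binary tetrahedral, octahedral and icosahedral groups). $G_1G_2\subset SO(4)$ denotes the image of $\tilde G_1\times\tilde G_2$.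
   Formalization: The products with the printed K_2, K_3, K_5' are not invariant; the formal version replaces x_3 by -x_3 in the brackets (x_2+x_3) and (x_2-x_3) of K_2 and K_3, and takes K_5' = -2(1-τ)(x_0x_3+x_1x_2)+2(x_0x_2-x_1x_3). *)

theory Defs
  imports
    "HOL-Analysis.Analysis"
    "HOL-Algebra.Generated_Groups"
    "HOL-Library.Poly_Mapping"
begin

section \<open>Quaternions as \<open>\<real>\<^sup>4\<close>\<close>

text \<open>The coordinates \<open>x\<^sub>0, \<dots>, x\<^sub>3\<close> are indexed by the numerals \<open>0, 1, 2, 3\<close> of the
  four-element type \<^typ>\<open>4\<close>, in which \<open>4 = 0\<close>.\<close>

type_synonym quat = "real ^ 4"

definition quat :: "real \<Rightarrow> real \<Rightarrow> real \<Rightarrow> real \<Rightarrow> quat" where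
  "quat a b c d =
     (\<chi> l. if l = 0 then a else if l = 1 then b else if l = 2 then c else d)"

definition qmult :: "quat \<Rightarrow> quat \<Rightarrow> quat"  (infixl \<open>\<star>\<close> 70) where
  "p \<star> r = quat
     (p $ 0 * r $ 0 - p $ 1 * r $ 1 - p $ 2 * r $ 2 - p $ 3 * r $ 3)
     (p $ 0 * r $ 1 + p $ 1 * r $ 0 + p $ 2 * r $ 3 - p $ 3 * r $ 2)
     (p $ 0 * r $ 2 - p $ 1 * r $ 3 + p $ 2 * r $ 0 + p $ 3 * r $ 1)
     (p $ 0 * r $ 3 + p $ 1 * r $ 2 - p $ 2 * r $ 1 + p $ 3 * r $ 0)"

definition unit_quats :: "quat monoid" where
  "unit_quats = \<lparr>carrier = {p. norm p = 1}, mult = (\<star>), one = quat 1 0 0 0\<rparr>"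

lemma quat_nth [simp]:
  "quat a b c d $ 0 = a" "quat a b c d $ 1 = b" "quat a b c d $ 2 = c" "quat a b c d $ 3 = d"
  by (simp_all add: quat_def)

lemma UNIV_4_from_0: "(UNIV :: 4 set) = {0, 1, 2, 3}"
  using UNIV_4 by auto

lemma all_4_from_0: "(\<forall>l::4. P l) \<longleftrightarrow> P 0 \<and> P 1 \<and> P 2 \<and> P 3"
  by (metis UNIV_4_from_0 UNIV_I empty_iff insert_iff)

lemma quat_eq_iff:
  "(p :: quat) = r \<longleftrightarrow> p $ 0 = r $ 0 \<and> p $ 1 = r $ 1 \<and> p $ 2 = r $ 2 \<and> p $ 3 = r $ 3"
  by (simp add: vec_eq_iff all_4_from_0)

lemma norm_quat_sq: "(norm (p :: quat))\<^sup>2 = (p $ 0)\<^sup>2 + (p $ 1)\<^sup>2 + (p $ 2)\<^sup>2 + (p $ 3)\<^sup>2"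
proof -
  have "(norm p)\<^sup>2 = (\<Sum>l\<in>UNIV. (p $ l)\<^sup>2)"
    by (simp add: norm_vec_def L2_set_def sum_nonneg)
  then show ?thesis
    unfolding UNIV_4_from_0 by simp
qed

lemma norm_qmult: "norm (p \<star> r) = norm p * norm r"
proof -
  have "(norm (p \<star> r))\<^sup>2 = (norm p * norm r)\<^sup>2"
    unfolding power_mult_distrib norm_quat_sq qmult_def quat_nth
    by (simp add: power2_eq_square algebra_simps)
  then show ?thesis
    by (simp add: power2_eq_iff_nonneg)
qed

definition qcnj :: "quat \<Rightarrow> quat" where
  "qcnj p = quat (p $ 0) (- p $ 1) (- p $ 2) (- p $ 3)"

lemma qcnj_qmult: "norm p = 1 \<Longrightarrow> qcnj p \<star> p = quat 1 0 0 0"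
  using norm_quat_sq[of p]
  by (simp add: quat_eq_iff qmult_def qcnj_def power2_eq_square algebra_simps)

lemma norm_qcnj: "norm (qcnj p) = norm p"
proof -
  have "(norm (qcnj p))\<^sup>2 = (norm p)\<^sup>2"
    unfolding norm_quat_sq qcnj_def by simp
  then show ?thesis
    by (simp add: power2_eq_iff_nonneg)
qed

lemma norm_quat_one: "norm (quat 1 0 0 0) = 1"
  using norm_quat_sq[of "quat 1 0 0 0"] by (simp add: power2_eq_1_iff) (smt (verit) norm_ge_zero)

lemma group_unit_quats: "group unit_quats"
proof (rule groupI)
  fix x y
  assume "x \<in> carrier unit_quats" "y \<in> carrier unit_quats"
  then show "x \<otimes>\<^bsub>unit_quats\<^esub> y \<in> carrier unit_quats"
    by (simp add: unit_quats_def norm_qmult)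
next
  fix x y z
  assume "x \<in> carrier unit_quats" "y \<in> carrier unit_quats" "z \<in> carrier unit_quats"
  show "x \<otimes>\<^bsub>unit_quats\<^esub> y \<otimes>\<^bsub>unit_quats\<^esub> z = x \<otimes>\<^bsub>unit_quats\<^esub> (y \<otimes>\<^bsub>unit_quats\<^esub> z)"
    by (simp add: unit_quats_def quat_eq_iff qmult_def algebra_simps)
next
  fix x assume "x \<in> carrier unit_quats"
  then show "\<exists>y\<in>carrier unit_quats. y \<otimes>\<^bsub>unit_quats\<^esub> x = \<one>\<^bsub>unit_quats\<^esub>"
    by (intro bexI[of _ "qcnj x"]) (simp_all add: unit_quats_def qcnj_qmult norm_qcnj)
qed (simp_all add: unit_quats_def norm_quat_one quat_eq_iff qmult_def)

lemma inv_unit_quats: "norm p = 1 \<Longrightarrow> inv\<^bsub>unit_quats\<^esub> p = qcnj p"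
  by (rule group.inv_equality[OF group_unit_quats])
    (simp_all add: unit_quats_def qcnj_qmult norm_qcnj)

section \<open>The binary polyhedral groups and their images in \<open>SO(4)\<close>\<close>

definition golden :: real where
  "golden = (1 + sqrt 5) / 2"

definition qi :: quat where "qi = quat 0 1 0 0"
definition qj :: quat where "qj = quat 0 0 1 0"
definition qS :: quat where "qS = quat (1/2) (1/2) (- 1/2) (1/2)"
definition qU :: quat where "qU = quat (golden / 2) 0 ((golden - 1) / 2) (1/2)"
definition qR :: "nat \<Rightarrow> quat" where "qR n = quat (cos (pi / n)) (sin (pi / n)) 0 0"

definition bin_dihedral :: "nat \<Rightarrow> quat set" where
  "bin_dihedral n = generate unit_quats {qj, qR n}"

definition bin_tetrahedral :: "quat set" where
  "bin_tetrahedral = generate unit_quats {qi, qS}"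

definition bin_octahedral :: "quat set" where
  "bin_octahedral = generate unit_quats {qi, qR 4, qS}"

definition bin_icosahedral :: "quat set" where
  "bin_icosahedral = generate unit_quats {qi, qS, qU}"

definition so4_image :: "quat set \<Rightarrow> quat set \<Rightarrow> (real ^ 4 ^ 4) set" where
  "so4_image G1 G2 =
     {matrix (\<lambda>p. g1 \<star> p \<star> inv\<^bsub>unit_quats\<^esub> g2) | g1 g2. g1 \<in> G1 \<and> g2 \<in> G2}"

section \<open>The polynomial ring \<open>\<complex>[x\<^sub>0, x\<^sub>1, x\<^sub>2, x\<^sub>3]\<close> and invariants\<close>

type_synonym poly4 = "(4 \<Rightarrow>\<^sub>0 nat) \<Rightarrow>\<^sub>0 complex"

definition Const :: "complex \<Rightarrow> poly4" where
  "Const c = Poly_Mapping.single 0 c"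

definition X :: "4 \<Rightarrow> poly4" where
  "X l = Poly_Mapping.single (Poly_Mapping.single l 1) 1"

definition pscale :: "complex \<Rightarrow> poly4 \<Rightarrow> poly4" where
  "pscale c f = Const c * f"

interpretation poly4: vector_space pscale
  by unfold_locales
    (simp_all add: pscale_def Const_def single_add mult_single algebra_simps flip: mult.assoc)

definition homogeneous :: "nat \<Rightarrow> poly4 \<Rightarrow> bool" where
  "homogeneous d f \<longleftrightarrow>
     (\<forall>m \<in> Poly_Mapping.keys f. (\<Sum>l\<in>UNIV. Poly_Mapping.lookup m l) = d)"

text \<open>Substitution of \<open>\<Sum>k. A\<^sub>l\<^sub>k x\<^sub>k\<close> for \<open>x\<^sub>l\<close>, that is, \<open>f \<mapsto> f \<circ> A\<close>. It differs from the left action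
  \<open>f \<mapsto> f \<circ> A\<^sup>-\<^sup>1\<close> by inversion, so that a group has the same invariants for both.\<close>

definition lin_subst :: "real ^ 4 ^ 4 \<Rightarrow> poly4 \<Rightarrow> poly4" where
  "lin_subst A f =
     (\<Sum>m \<in> Poly_Mapping.keys f. Const (Poly_Mapping.lookup f m) *
        (\<Prod>l\<in>UNIV. (\<Sum>k\<in>UNIV. Const (of_real (A $ l $ k)) * X k) ^ Poly_Mapping.lookup m l))"

definition invariants :: "(real ^ 4 ^ 4) set \<Rightarrow> nat \<Rightarrow> poly4 set" where
  "invariants G d = {f. homogeneous d f \<and> (\<forall>A\<in>G. lin_subst A f = f)}"

section \<open>The generators\<close>

definition q :: poly4 where
  "q = X 0 ^ 2 + X 1 ^ 2 + X 2 ^ 2 + X 3 ^ 2"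

definition f2 :: poly4 where
  "f2 = 2 * (X 0 ^ 2 * X 2 ^ 2 + X 1 ^ 2 * X 3 ^ 2)"

definition f3 :: poly4 where
  "f3 = 2 * (X 0 ^ 2 * X 3 ^ 2 + X 1 ^ 2 * X 2 ^ 2)"

definition tau :: poly4 where
  "tau = Const (of_real golden)"

text \<open>Let \<open>A\<close>, \<open>B\<close>, \<open>C\<close> be the \<open>i\<close>, \<open>j\<close>, \<open>k\<close> components of \<open>p i p\<^sup>*\<close> for \<open>p = x\<^sub>0 + x\<^sub>1 i + x\<^sub>2 j + x\<^sub>3 k\<close>,
  that is, \<open>A = x\<^sub>0\<^sup>2 + x\<^sub>1\<^sup>2 - x\<^sub>2\<^sup>2 - x\<^sub>3\<^sup>2\<close>, \<open>B = 2 (x\<^sub>0 x\<^sub>3 + x\<^sub>1 x\<^sub>2)\<close>, \<open>C = 2 (x\<^sub>1 x\<^sub>3 - x\<^sub>0 x\<^sub>2)\<close>.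
  The factors of \<open>P8\<close> are \<open>A \<plusminus> B \<plusminus> C\<close>, one for each threefold axis of the tetrahedron, and those
  of \<open>P12\<close> are multiples of linear forms in \<open>A, B, C\<close>, one for each fivefold axis of the icosahedron.

  Two misprints of the source are corrected, without which the products are not invariant and the
  claims are false. The source has \<open>X 3\<close> for \<open>y\<close> in all four \<open>K8 i\<close>, so that \<open>K8 2\<close> and \<open>K8 3\<close> are not
  combinations of \<open>A, B, C\<close>: for \<open>p = (2, 1, 0, 0)\<close> and \<open>S p = (1/2, 3/2, -1/2, 3/2)\<close> the product
  has the values 625 and 1225. In \<open>K12 5\<close> the source has \<open>- 2 \<tau>\<close> for \<open>- 2 (1 - \<tau>)\<close>: for \<open>p = (1, 1, 1, 0)\<close>
  and \<open>S p = (1/2, 1/2, 1/2, 3/2)\<close> the product has the values \<open>60 - 40 \<tau>\<close> and \<open>- 60 - 100 \<tau>\<close>.\<close>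

definition K8 :: "nat \<Rightarrow> poly4" where
  "K8 i = (let y = (if i \<in> {0, 1} then X 3 else - X 3) in
     X 0 ^ 2 + X 1 ^ 2 - X 2 ^ 2 - X 3 ^ 2 + (- 1) ^ i * 2 * X 0 * (X 2 + y)
     + (if i \<in> {0, 3} then 2 * X 1 * (X 2 - y) else - 2 * X 1 * (X 2 - y)))"

definition P8 :: poly4 where
  "P8 = (\<Prod>i = 0..3. K8 i)"

definition K12 :: "nat \<Rightarrow> poly4" where
  "K12 i =
    [X 0 ^ 2 + X 1 ^ 2 - X 2 ^ 2 - X 3 ^ 2 + 2 * (1 - tau) * (X 0 * X 2 - X 1 * X 3),
     X 0 ^ 2 + X 1 ^ 2 - X 2 ^ 2 - X 3 ^ 2 + 2 * tau * (X 0 * X 3 + X 1 * X 2),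
     X 0 ^ 2 + X 1 ^ 2 - X 2 ^ 2 - X 3 ^ 2 - 2 * (1 - tau) * (X 0 * X 2 - X 1 * X 3),
     X 0 ^ 2 + X 1 ^ 2 - X 2 ^ 2 - X 3 ^ 2 - 2 * tau * (X 0 * X 3 + X 1 * X 2),
     2 * (1 - tau) * (X 0 * X 3 + X 1 * X 2) + 2 * (X 0 * X 2 - X 1 * X 3),
     - 2 * (1 - tau) * (X 0 * X 3 + X 1 * X 2) + 2 * (X 0 * X 2 - X 1 * X 3)] ! i"

definition P12 :: poly4 where
  "P12 = (\<Prod>i = 0..5. K12 i)"

end

theory Submission
  imports Defs
begin

text \<open>
  Write \<open>z = x\<^sub>0 + x\<^sub>1 i\<close> and \<open>w = x\<^sub>2 + x\<^sub>3 i\<close>, so that \<open>p = z + w j\<close>. Right multiplication by \<open>R\<^sub>n\<close> scales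
  \<open>z\<close> and the conjugate of \<open>w\<close> by one root of unity and the other two coordinates by its inverse. For
  \<open>n > k\<close> the invariants of degree \<open>2 k\<close> are therefore spanned by the monomials of degree \<open>k\<close> in each pair,
  that is, by products of \<open>k\<close> factors among \<open>q\<close> and the components \<open>A, B, C\<close> of \<open>p i p\<^sup>*\<close>.
  Right multiplication by \<open>j\<close> fixes \<open>q\<close> and negates \<open>A, B, C\<close>; since \<open>q\<^sup>2 = A\<^sup>2 + B\<^sup>2 + C\<^sup>2\<close>, for even \<open>k\<close>
  only the forms of degree \<open>k\<close> in \<open>A, B, C\<close> survive.
  The left factor acts on \<open>(A, B, C)\<close> by rotations, and its invariants of degree \<open>k = 2, 4, 6\<close> are found by
  averaging over \<open>i\<close>, \<open>j\<close> (only squares survive), over \<open>R\<^sub>n\<close>, or over \<open>S\<close>, which permutes the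
  squares cyclically. In the icosahedral case four cyclic sums remain, and comparing values at two points
  with their images under \<open>U\<close> leaves two parameters.
\<close>

section \<open>Evaluation homomorphisms and the action on polynomials\<close>

lemma poly4_eq_sum_single:
  "(f :: poly4) = (\<Sum>m\<in>Poly_Mapping.keys f. Poly_Mapping.single m (Poly_Mapping.lookup f m))"
proof (rule poly_mapping_eqI)
  fix k
  show "Poly_Mapping.lookup f k =
    Poly_Mapping.lookup (\<Sum>m\<in>Poly_Mapping.keys f. Poly_Mapping.single m (Poly_Mapping.lookup f m)) k"
    by (auto simp: lookup_sum lookup_single when_def in_keys_iff)
qed

lemma X_power: "X l ^ n = Poly_Mapping.single (Poly_Mapping.single l n) 1"
proof (induction n)
  case (Suc n)
  then show ?case
    by (simp add: X_def mult_single flip: single_add)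
qed simp

lemma single_eq_monomial:
  "(Poly_Mapping.single m a :: poly4) = Const a * (\<Prod>l\<in>UNIV. X l ^ Poly_Mapping.lookup m l)"
proof -
  have "m = Poly_Mapping.single 0 (Poly_Mapping.lookup m 0) + (Poly_Mapping.single 1 (Poly_Mapping.lookup m 1)
     + (Poly_Mapping.single 2 (Poly_Mapping.lookup m 2) + Poly_Mapping.single 3 (Poly_Mapping.lookup m 3)))"
    (is "_ = ?s")
  proof (rule poly_mapping_eqI)
    fix l
    have "\<forall>l. Poly_Mapping.lookup m l = Poly_Mapping.lookup ?s l"
      unfolding all_4_from_0 lookup_add lookup_single by simp
    then show "Poly_Mapping.lookup m l = Poly_Mapping.lookup ?s l" ..
  qed
  then show ?thesis
    unfolding UNIV_4_from_0 X_power Const_def by (simp add: mult_single)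
qed

lemma Const_add: "Const (a + b) = Const a + Const b"
  by (simp add: Const_def single_add)

lemma Const_mult: "Const (a * b) = Const a * Const b"
  by (simp add: Const_def mult_single)

lemma Const_0 [simp]: "Const 0 = 0"
  by (simp add: Const_def)

lemma Const_1 [simp]: "Const 1 = 1"
  by (simp add: Const_def)

lemma Const_minus: "Const (- a) = - Const a"
  by (simp add: Const_def single_uminus)

lemma Const_diff: "Const (a - b) = Const a - Const b"
  by (simp add: Const_def single_diff)

lemma Const_numeral: "Const (numeral n) = numeral n"
  by (simp add: Const_def)

lemma Const_power: "Const (a ^ n) = Const a ^ n"
  by (induction n) (simp_all add: Const_mult)

lemma Const_sum: "Const (sum h M) = (\<Sum>m\<in>M. Const (h m))"
  by (induction M rule: infinite_finite_induct) (simp_all add: Const_add)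

lemmas Const_hom = Const_add Const_mult Const_minus Const_diff Const_numeral Const_power

text \<open>Reduces identities of ring homomorphisms on \<open>poly4\<close> to constants and
  variables; this is how compositions of substitutions are computed.\<close>

lemma poly4_induct [case_names Const X add mult]:
  assumes "\<And>c. P (Const c)" "\<And>l. P (X l)"
    and add: "\<And>f g. P f \<Longrightarrow> P g \<Longrightarrow> P (f + g)"
    and mult: "\<And>f g. P f \<Longrightarrow> P g \<Longrightarrow> P (f * g)"
  shows "P (f :: poly4)"
proof -
  have pow: "P (X l ^ n)" for l n
    by (induction n) (use assms(1)[of 1] assms(2) mult in auto)
  have single: "P (Poly_Mapping.single m a)" for m a
    unfolding single_eq_monomial UNIV_4_from_0 by (simp add: assms(1) mult pow)
  have "P (\<Sum>m\<in>M. Poly_Mapping.single m (Poly_Mapping.lookup f m))" if "finite M" for M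
    using that by (induction M) (use assms(1)[of 0] add single in auto)
  then show ?thesis
    using poly4_eq_sum_single[of f] by (metis finite_keys)
qed

text \<open>One development of evaluation serves two purposes: with \<open>Const\<close> as
  coefficient map it is substitution of polynomials, with the identity it is evaluation at a complex
  point.\<close>

locale coeff_hom =
  fixes c :: "complex \<Rightarrow> 'a :: comm_ring_1"
  assumes c_add: "c (x + y) = c x + c y"
    and c_mult: "c (x * y) = c x * c y"
    and c_one: "c 1 = 1"
begin

lemma c_zero: "c 0 = 0"
  using c_add[of 0 0] by simp

definition insertion :: "(4 \<Rightarrow> 'a) \<Rightarrow> poly4 \<Rightarrow> 'a" where
  "insertion v f = (\<Sum>m\<in>Poly_Mapping.keys f.
     c (Poly_Mapping.lookup f m) * (\<Prod>l\<in>UNIV. v l ^ Poly_Mapping.lookup m l))"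

lemma insertion_add: "insertion v (f + g) = insertion v f + insertion v g"
  unfolding insertion_def
  by (rule setsum_keys_plus_distrib) (simp_all add: c_add c_zero algebra_simps)

lemma insertion_single:
  "insertion v (Poly_Mapping.single m a) = c a * (\<Prod>l\<in>UNIV. v l ^ Poly_Mapping.lookup m l)"
  by (simp add: insertion_def c_zero)

lemma insertion_0 [simp]: "insertion v 0 = 0"
  by (simp add: insertion_def)

lemma insertion_sum: "insertion v (sum h M) = (\<Sum>m\<in>M. insertion v (h m))"
  by (induction M rule: infinite_finite_induct) (simp_all add: insertion_add)

lemma insertion_mult: "insertion v (f * g) = insertion v f * insertion v g"
proof -
  have s: "insertion v (Poly_Mapping.single m a * Poly_Mapping.single n b) =
    insertion v (Poly_Mapping.single m a) * insertion v (Poly_Mapping.single n b)" for m n a b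
    by (simp add: mult_single insertion_single c_mult lookup_add power_add prod.distrib algebra_simps)
  define sf sg where "sf m = Poly_Mapping.single m (Poly_Mapping.lookup f m)"
    and "sg m = Poly_Mapping.single m (Poly_Mapping.lookup g m)" for m
  have "f = sum sf (Poly_Mapping.keys f)" "g = sum sg (Poly_Mapping.keys g)"
    unfolding sf_def sg_def by (rule poly4_eq_sum_single)+
  moreover have "insertion v (sum sf M * sum sg N) = insertion v (sum sf M) * insertion v (sum sg N)" for M N
    by (simp only: sum_product insertion_sum s sf_def sg_def)
  ultimately show ?thesis
    by metis
qed

lemma insertion_Const [simp]: "insertion v (Const a) = c a"
  by (simp add: Const_def insertion_single)

lemma insertion_X [simp]: "insertion v (X l) = v l"
proof -
  have "(\<Prod>l'\<in>UNIV. v l' ^ Poly_Mapping.lookup (Poly_Mapping.single l 1) l') =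
     (\<Prod>l'\<in>UNIV. if l' = l then v l else 1)"
    by (intro prod.cong) (auto simp: lookup_single when_def)
  then show ?thesis
    by (simp add: X_def insertion_single c_one)
qed

lemma insertion_1 [simp]: "insertion v 1 = 1"
  using insertion_Const[of v 1] by (simp add: c_one)

lemma insertion_minus: "insertion v (- f) = - insertion v f"
  using insertion_add[of v f "- f"] by (simp add: eq_neg_iff_add_eq_0 add.commute)

lemma insertion_diff: "insertion v (f - g) = insertion v f - insertion v g"
  using insertion_add[of v f "- g"] by (simp add: insertion_minus)

lemma insertion_power: "insertion v (f ^ n) = insertion v f ^ n"
  by (induction n) (simp_all add: insertion_mult)

lemma insertion_numeral [simp]: "insertion v (numeral n) = numeral n"
proof -
  have "insertion v (of_nat k) = of_nat k" for k
    by (induction k) (simp_all add: insertion_add)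
  from this[of "numeral n"] show ?thesis by simp
qed

lemma insertion_prod: "insertion v (prod h M) = (\<Prod>m\<in>M. insertion v (h m))"
  by (induction M rule: infinite_finite_induct) (simp_all add: insertion_mult)

lemma insertion_pscale: "insertion v (pscale a f) = c a * insertion v f"
  by (simp add: pscale_def insertion_mult)

lemmas insertion_hom = insertion_add insertion_mult insertion_minus insertion_diff insertion_power
  insertion_prod insertion_sum insertion_pscale

end

interpretation subst: coeff_hom Const
  by unfold_locales (simp_all add: Const_hom)

interpretation eval: coeff_hom "\<lambda>x :: complex. x"
  by unfold_locales simp_all

section \<open>The two-sided action of pairs of quaternions\<close>

definition lin_form :: "real ^ 4 ^ 4 \<Rightarrow> 4 \<Rightarrow> poly4" where
  "lin_form A l = (\<Sum>k\<in>UNIV. Const (of_real (A $ l $ k)) * X k)"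

lemma lin_subst_eq_insertion: "lin_subst A = subst.insertion (lin_form A)"
  by (simp add: fun_eq_iff lin_subst_def subst.insertion_def lin_form_def)

text \<open>Substitution is precomposition, so the order of the matrices is reversed.\<close>

lemma lin_subst_comp: "lin_subst A (lin_subst B f) = lin_subst (B ** A) f"
proof (induction f rule: poly4_induct)
  case (X l)
  have "(\<Sum>k\<in>UNIV. Const (of_real (B $ l $ k)) * (\<Sum>j\<in>UNIV. Const (of_real (A $ k $ j)) * X j)) =
      (\<Sum>j\<in>UNIV. \<Sum>k\<in>UNIV. Const (of_real (B $ l $ k)) * (Const (of_real (A $ k $ j)) * X j))"
    by (subst sum.swap) (simp add: sum_distrib_left)
  also have "\<dots> = (\<Sum>j\<in>UNIV. Const (of_real ((B ** A) $ l $ j)) * X j)"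
    by (intro sum.cong refl)
      (simp add: matrix_matrix_mult_def sum_distrib_right Const_sum Const_mult mult.assoc)
  finally show ?case
    by (simp add: lin_subst_eq_insertion subst.insertion_hom lin_form_def)
qed (simp_all add: lin_subst_eq_insertion subst.insertion_hom)

text \<open>The conjugate takes the place of the inverse, with which it agrees on unit quaternions,
  so that the action is given by polynomials in the entries of \<open>g\<close> and \<open>h\<close>
  without any assumption on norms.\<close>

definition act :: "quat \<Rightarrow> quat \<Rightarrow> poly4 \<Rightarrow> poly4" where
  "act g h = lin_subst (matrix (\<lambda>p. g \<star> p \<star> qcnj h))"

lemma linear_sandwich: "linear (\<lambda>p. g \<star> p \<star> h)"
  by (rule linearI) (simp_all add: quat_eq_iff qmult_def algebra_simps)

lemma qmult_assoc: "p \<star> r \<star> s = p \<star> (r \<star> s)"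
  by (simp add: quat_eq_iff qmult_def algebra_simps)

lemma qcnj_mult: "qcnj (p \<star> r) = qcnj r \<star> qcnj p"
  by (simp add: quat_eq_iff qmult_def qcnj_def algebra_simps)

lemma act_comp: "act g h (act g' h' f) = act (g' \<star> g) (h' \<star> h) f"
proof -
  have "matrix (\<lambda>p. g' \<star> p \<star> qcnj h') ** matrix (\<lambda>p. g \<star> p \<star> qcnj h) =
     matrix ((\<lambda>p. g' \<star> p \<star> qcnj h') \<circ> (\<lambda>p. g \<star> p \<star> qcnj h))"
    by (rule matrix_compose[symmetric]) (rule linear_sandwich)+
  also have "(\<lambda>p. g' \<star> p \<star> qcnj h') \<circ> (\<lambda>p. g \<star> p \<star> qcnj h) = (\<lambda>p. (g' \<star> g) \<star> p \<star> qcnj (h' \<star> h))"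
    by (simp add: fun_eq_iff qmult_assoc qcnj_mult)
  finally show ?thesis
    by (simp add: act_def lin_subst_comp)
qed

lemma act_eq_insertion: "act g h = subst.insertion (lin_form (matrix (\<lambda>p. g \<star> p \<star> qcnj h)))"
  by (simp add: act_def lin_subst_eq_insertion)

lemmas act_hom = subst.insertion_hom[of "lin_form (matrix (\<lambda>p. g \<star> p \<star> qcnj h))" for g h, 
   folded act_eq_insertion]

lemma act_Const [simp]: "act g h (Const a) = Const a"
  and act_0 [simp]: "act g h 0 = 0"
  and act_1 [simp]: "act g h 1 = 1"
  and act_numeral [simp]: "act g h (numeral n) = numeral n"
  by (simp_all add: act_eq_insertion)

abbreviation qone :: quat where "qone \<equiv> quat 1 0 0 0"

abbreviation rconst :: "real \<Rightarrow> poly4" where "rconst x \<equiv> Const (complex_of_real x)"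

lemma act_X: "act g h (X l) = (\<Sum>k\<in>UNIV. rconst ((g \<star> axis k 1 \<star> qcnj h) $ l) * X k)"
  by (simp add: act_eq_insertion lin_form_def matrix_def)

lemma qmult_quat: "p \<star> quat a b c d = quat
     (p $ 0 * a - p $ 1 * b - p $ 2 * c - p $ 3 * d)
     (p $ 0 * b + p $ 1 * a + p $ 2 * d - p $ 3 * c)
     (p $ 0 * c - p $ 1 * d + p $ 2 * a + p $ 3 * b)
     (p $ 0 * d + p $ 1 * c - p $ 2 * b + p $ 3 * a)"
  by (simp add: qmult_def)

lemma qmult_one [simp]: "p \<star> qone = p" "qone \<star> p = p"
  by (simp_all add: quat_eq_iff qmult_def)

lemma qcnj_quat: "qcnj (quat a b c d) = quat a (- b) (- c) (- d)"
  by (simp add: qcnj_def)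

lemma axis_eq_quat:
  "axis 0 1 = quat 1 0 0 0" "axis 1 1 = quat 0 1 0 0" "axis 2 1 = quat 0 0 1 0" "axis 3 1 = quat 0 0 0 1"
  by (simp_all add: quat_eq_iff axis_def)

lemma sum_4_from_0: "sum h (UNIV :: 4 set) = h 0 + h 1 + h 2 + h 3"
  unfolding UNIV_4_from_0 by (simp add: add.assoc)

lemma act_left_X:
  "act g qone (X 0) = rconst (g $ 0) * X 0 - rconst (g $ 1) * X 1 - rconst (g $ 2) * X 2 - rconst (g $ 3) * X 3"
  "act g qone (X 1) = rconst (g $ 1) * X 0 + rconst (g $ 0) * X 1 - rconst (g $ 3) * X 2 + rconst (g $ 2) * X 3"
  "act g qone (X 2) = rconst (g $ 2) * X 0 + rconst (g $ 3) * X 1 + rconst (g $ 0) * X 2 - rconst (g $ 1) * X 3"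
  "act g qone (X 3) = rconst (g $ 3) * X 0 - rconst (g $ 2) * X 1 + rconst (g $ 1) * X 2 + rconst (g $ 0) * X 3"
  by (simp_all add: act_X sum_4_from_0 axis_eq_quat qmult_quat qcnj_quat Const_minus)

lemma act_right_X:
  "act qone g (X 0) = rconst (g $ 0) * X 0 + rconst (g $ 1) * X 1 + rconst (g $ 2) * X 2 + rconst (g $ 3) * X 3"
  "act qone g (X 1) = rconst (g $ 0) * X 1 - rconst (g $ 1) * X 0 - rconst (g $ 3) * X 2 + rconst (g $ 2) * X 3"
  "act qone g (X 2) = rconst (g $ 0) * X 2 - rconst (g $ 2) * X 0 + rconst (g $ 3) * X 1 - rconst (g $ 1) * X 3"
  "act qone g (X 3) = rconst (g $ 0) * X 3 - rconst (g $ 3) * X 0 - rconst (g $ 2) * X 1 + rconst (g $ 1) * X 2"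
  by (simp_all add: act_X sum_4_from_0 axis_eq_quat qmult_quat qcnj_def Const_minus)

lemma act_id [simp]: "act qone qone f = f"
proof (induction f rule: poly4_induct)
  case (X l)
  have "\<forall>l. act qone qone (X l) = X l"
    unfolding all_4_from_0 act_left_X by simp
  then show ?case ..
qed (simp_all add: act_hom)

lemma act_left_right: "act g h f = act g qone (act qone h f)"
  by (simp add: act_comp)

text \<open>\<open>T\<close> stands for the left or the right action, both of which reverse
  products. An inverse is handled by writing \<open>f\<close> as \<open>T h f\<close> and composing,
  which gives \<open>T qone f\<close>.\<close>

lemma fixed_by_generate:
  assumes "g \<in> generate unit_quats S" "S \<subseteq> carrier unit_quats"
    and one: "T qone f = f" and comp: "\<And>g h. T g (T h f) = T (h \<star> g) f"
    and fixed: "\<And>g. g \<in> S \<Longrightarrow> T g f = f"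
  shows "T g f = f"
  using assms(1)
proof induction
  case (inv h)
  then have "h \<in> carrier unit_quats"
    using assms(2) by blast
  then have "h \<star> inv\<^bsub>unit_quats\<^esub> h = qone"
    using group.r_inv[OF group_unit_quats] by (simp add: unit_quats_def)
  then show ?case
    using comp[of "inv\<^bsub>unit_quats\<^esub> h" h] fixed[OF inv] one by simp
next
  case (eng h1 h2)
  then show ?case
    using comp[of h2 h1] by (simp add: unit_quats_def)
qed (use one fixed in \<open>simp_all add: unit_quats_def\<close>)

text \<open>Each group contains \<open>qone\<close> and every pair acts as a left followed by a
  right multiplication, so invariance splits into the two one-sided conditions; each of these is
  inherited from the generators.\<close>

lemma invariants_generate:
  assumes S1: "S1 \<subseteq> carrier unit_quats" and S2: "S2 \<subseteq> carrier unit_quats"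
  shows "f \<in> invariants (so4_image (generate unit_quats S1) (generate unit_quats S2)) d \<longleftrightarrow>
    homogeneous d f \<and> (\<forall>g\<in>S1. act g qone f = f) \<and> (\<forall>h\<in>S2. act qone h f = f)"
proof -
  have norm1: "norm h = 1" if "h \<in> generate unit_quats S2" for h
    using group.generate_in_carrier[OF group_unit_quats S2 that] by (simp add: unit_quats_def)
  have *: "(\<forall>A\<in>so4_image (generate unit_quats S1) (generate unit_quats S2). lin_subst A f = f) \<longleftrightarrow>
    (\<forall>g\<in>generate unit_quats S1. \<forall>h\<in>generate unit_quats S2. act g h f = f)"
    unfolding so4_image_def act_def by (auto simp: norm1 inv_unit_quats) (metis norm1 inv_unit_quats)
  have one: "qone \<in> generate unit_quats S" for S
    using generate.one[of unit_quats S] by (simp add: unit_quats_def)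
  have l: "act g qone f = f" if "\<forall>g\<in>S1. act g qone f = f" "g \<in> generate unit_quats S1" for g
    by (rule fixed_by_generate[where T = "\<lambda>g. act g qone", OF that(2) S1]) (use that in \<open>simp_all add: act_comp\<close>)
  have r: "act qone g f = f" if "\<forall>g\<in>S2. act qone g f = f" "g \<in> generate unit_quats S2" for g
    by (rule fixed_by_generate[where T = "act qone", OF that(2) S2]) (use that in \<open>simp_all add: act_comp\<close>)
  have "(\<forall>g\<in>generate unit_quats S1. \<forall>h\<in>generate unit_quats S2. act g h f = f) \<longleftrightarrow>
    (\<forall>g\<in>S1. act g qone f = f) \<and> (\<forall>h\<in>S2. act qone h f = f)"
    using one l r by (metis act_left_right generate.incl)
  then show ?thesis
    by (simp add: invariants_def *)
qed

text \<open>The forms \<open>A\<close>, \<open>B\<close>, \<open>C\<close> in which \<open>P8\<close> and \<open>P12\<close> factor.\<close>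

definition AA :: poly4 where "AA = X 0 ^ 2 + X 1 ^ 2 - X 2 ^ 2 - X 3 ^ 2"
definition BB :: poly4 where "BB = 2 * (X 0 * X 3 + X 1 * X 2)"
definition CC :: poly4 where "CC = 2 * (X 1 * X 3 - X 0 * X 2)"

text \<open>\<open>AA\<close>, \<open>BB\<close>, \<open>CC\<close> are the components of
  \<open>p i p*\<close>, whose norm is the squared norm of \<open>p\<close>, that is,
  \<open>q\<close>.\<close>

lemma q_sq: "q ^ 2 = AA ^ 2 + BB ^ 2 + CC ^ 2"
  unfolding q_def AA_def BB_def CC_def by algebra

text \<open>Replacing \<open>p\<close> by \<open>g p\<close> conjugates \<open>p i p*\<close> by
  \<open>g\<close>; the coefficients here and in the next two lemmas are the rows of this rotation,
  scaled by the squared norm of \<open>g\<close>.\<close>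

lemma act_left_AA: "act g qone AA = rconst ((g $ 0)\<^sup>2 + (g $ 1)\<^sup>2 - (g $ 2)\<^sup>2 - (g $ 3)\<^sup>2) * AA
    + rconst (2 * (g $ 1 * g $ 2 - g $ 0 * g $ 3)) * BB + rconst (2 * (g $ 1 * g $ 3 + g $ 0 * g $ 2)) * CC"
  unfolding AA_def BB_def CC_def act_hom act_left_X act_numeral
    of_real_add of_real_diff of_real_mult of_real_power of_real_numeral Const_hom
  by algebra

lemma act_left_BB: "act g qone BB = rconst (2 * (g $ 1 * g $ 2 + g $ 0 * g $ 3)) * AA
    + rconst ((g $ 0)\<^sup>2 - (g $ 1)\<^sup>2 + (g $ 2)\<^sup>2 - (g $ 3)\<^sup>2) * BB + rconst (2 * (g $ 2 * g $ 3 - g $ 0 * g $ 1)) * CC"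
  unfolding AA_def BB_def CC_def act_hom act_left_X act_numeral
    of_real_add of_real_diff of_real_mult of_real_power of_real_numeral Const_hom
  by algebra

lemma act_left_CC: "act g qone CC = rconst (2 * (g $ 1 * g $ 3 - g $ 0 * g $ 2)) * AA
    + rconst (2 * (g $ 2 * g $ 3 + g $ 0 * g $ 1)) * BB + rconst ((g $ 0)\<^sup>2 - (g $ 1)\<^sup>2 - (g $ 2)\<^sup>2 + (g $ 3)\<^sup>2) * CC"
  unfolding AA_def BB_def CC_def act_hom act_left_X act_numeral
    of_real_add of_real_diff of_real_mult of_real_power of_real_numeral Const_hom
  by algebra

lemma act_left_q: "act g qone q = rconst ((norm g)\<^sup>2) * q"
  unfolding norm_quat_sq q_def act_hom act_left_X act_numeral
    of_real_add of_real_diff of_real_mult of_real_power of_real_numeral Const_hom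
  by algebra

lemma act_right_q: "act qone g q = rconst ((norm g)\<^sup>2) * q"
  unfolding norm_quat_sq q_def act_hom act_right_X act_numeral
    of_real_add of_real_diff of_real_mult of_real_power of_real_numeral Const_hom
  by algebra

lemma norm_qR [simp]: "norm (qR n) = 1"
  using norm_quat_sq[of "qR n"] by (simp add: qR_def power2_eq_1_iff) (smt (verit) norm_ge_zero)

text \<open>The right action of \<open>h\<close> turns \<open>p i p*\<close> into
  \<open>p (h* i h) p*\<close>, and \<open>qR n\<close> commutes with \<open>i\<close>. For
  \<open>qj\<close> in the next lemma, \<open>h* i h = -i\<close>.\<close>

lemma act_right_qR:
  "act qone (qR n) AA = AA" "act qone (qR n) BB = BB" "act qone (qR n) CC = CC"
proof -
  have *: "rconst (cos (pi / n)) ^ 2 + rconst (sin (pi / n)) ^ 2 = 1"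
    using arg_cong[OF sin_cos_squared_add2[of "pi / n"], of rconst]
    by (simp only: of_real_add of_real_power of_real_1 Const_hom Const_1)
  show "act qone (qR n) AA = AA" "act qone (qR n) BB = BB" "act qone (qR n) CC = CC"
    unfolding AA_def BB_def CC_def act_hom act_right_X act_numeral qR_def quat_nth of_real_0 Const_0
    using * by algebra+
qed

lemma act_right_qj:
  "act qone qj AA = - AA" "act qone qj BB = - BB" "act qone qj CC = - CC"
    unfolding AA_def BB_def CC_def act_hom act_right_X act_numeral qj_def quat_nth of_real_0 Const_0 of_real_1 Const_1
    by algebra+

section \<open>Products of generators and averaging\<close>

lemma pscale_mult_left: "pscale a f * g = pscale a (f * g)"
  and pscale_mult_right: "g * pscale a f = pscale a (g * f)"
  by (simp_all add: pscale_def mult_ac)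

lemma span_mult:
  assumes "a \<in> poly4.span S" "b \<in> poly4.span T"
  shows "a * b \<in> poly4.span {s * t |s t. s \<in> S \<and> t \<in> T}"
  using assms(1)
proof (induction rule: poly4.span_induct_alt)
  case (step c s y)
  have "s * b \<in> poly4.span {s * t |s t. s \<in> S \<and> t \<in> T}"
    using assms(2)
  proof (induction rule: poly4.span_induct_alt)
    case (step d t z)
    have "s * t \<in> poly4.span {s * t |s t. s \<in> S \<and> t \<in> T}"
      using \<open>s \<in> S\<close> step(1) by (intro poly4.span_base) blast
    then show ?case
      using step(2) by (simp add: distrib_left pscale_mult_right poly4.span_add poly4.span_scale)
  qed (simp add: poly4.span_zero)
  then show ?case
    using step(2) by (simp add: distrib_right pscale_mult_left poly4.span_add poly4.span_scale)
qed (simp add: poly4.span_zero)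

text \<open>A common form for the spanning sets of all reduction steps: monomials in the variables
  first, then in complex coordinates, in quadratic forms, and in squares of these.\<close>

fun prods :: "poly4 set \<Rightarrow> nat \<Rightarrow> poly4 set" where
  "prods T 0 = {1}"
| "prods T (Suc d) = {t * m |t m. t \<in> T \<and> m \<in> prods T d}"

text \<open>A linear change of generators may be carried out inside each factor of a
  product.\<close>

lemma span_prods_mono:
  assumes "S \<subseteq> poly4.span T"
  shows "poly4.span (prods S d) \<subseteq> poly4.span (prods T d)"
proof (rule poly4.span_minimal[OF _ poly4.subspace_span])
  show "prods S d \<subseteq> poly4.span (prods T d)"
  proof (induction d)
    case 0
    then show ?case
      by (auto intro: poly4.span_base)
  next
    case (Suc d)
    then show ?case
      using span_mult[of _ T _ "prods T d"] assms by auto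
  qed
qed

lemma prods_mult: "a \<in> prods T m \<Longrightarrow> b \<in> prods T n \<Longrightarrow> a * b \<in> prods T (m + n)"
  by (induction m arbitrary: a) (force simp: mult.assoc)+

lemma prods_power: "t \<in> T \<Longrightarrow> t ^ n \<in> prods T n"
  by (induction n) auto

lemma span_prods_mult:
  assumes "a \<in> poly4.span (prods T m)" "b \<in> poly4.span (prods T n)"
  shows "a * b \<in> poly4.span (prods T (m + n))"
proof -
  have "{s * t |s t. s \<in> prods T m \<and> t \<in> prods T n} \<subseteq> prods T (m + n)"
    using prods_mult by blast
  then show ?thesis
    using span_mult[OF assms] poly4.span_mono by blast
qed

lemma span_prods_power:
  assumes "a \<in> poly4.span (prods T m)"
  shows "a ^ n \<in> poly4.span (prods T (n * m))"
proof (induction n)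
  case 0
  then show ?case
    by (auto intro: poly4.span_base)
next
  case (Suc n)
  then show ?case
    using span_prods_mult[OF assms] by simp
qed

lemma homogeneous_in_span:
  assumes "homogeneous d f"
  shows "f \<in> poly4.span (prods (range X) d)"
proof -
  have "Poly_Mapping.single m (Poly_Mapping.lookup f m) \<in> poly4.span (prods (range X) d)"
    if "m \<in> Poly_Mapping.keys f" for m
  proof -
    let ?e = "Poly_Mapping.lookup m"
    have "(\<Prod>l\<in>UNIV. X l ^ ?e l) \<in> prods (range X) (?e 0 + (?e 1 + (?e 2 + ?e 3)))"
      unfolding UNIV_4_from_0 by simp (intro prods_mult prods_power; simp)
    also have "?e 0 + (?e 1 + (?e 2 + ?e 3)) = d"
      using assms that by (simp add: homogeneous_def sum_4_from_0 add.assoc)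
    finally show ?thesis
      unfolding single_eq_monomial pscale_def[symmetric] by (intro poly4.span_scale poly4.span_base)
  qed
  then show ?thesis
    by (subst poly4_eq_sum_single) (intro poly4.span_sum)
qed

lemma prods_Un:
  "m \<in> prods (S \<union> T) d \<Longrightarrow> \<exists>a b m1 m2. a + b = d \<and> m1 \<in> prods S a \<and> m2 \<in> prods T b \<and> m = m1 * m2"
proof (induction d arbitrary: m)
  case (Suc d)
  then obtain t m' where t: "t \<in> S \<union> T" "m' \<in> prods (S \<union> T) d" "m = t * m'"
    by auto
  then obtain a b m1 m2 where *: "a + b = d" "m1 \<in> prods S a" "m2 \<in> prods T b" "m' = m1 * m2"
    using Suc.IH by blast
  show ?case
  proof (cases "t \<in> S")
    case True
    then have "Suc a + b = Suc d \<and> t * m1 \<in> prods S (Suc a) \<and> m2 \<in> prods T b \<and> m = t * m1 * m2"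
      using * t True by (auto simp: mult.assoc)
    then show ?thesis by blast
  next
    case False
    then have "a + Suc b = Suc d \<and> m1 \<in> prods S a \<and> t * m2 \<in> prods T (Suc b) \<and> m = m1 * (t * m2)"
      using * t False by (auto simp: mult.left_commute)
    then show ?thesis by blast
  qed
qed simp

text \<open>Pairs off equal numbers of factors of two kinds, which turns degree \<open>2 * k\<close>
  in linear forms into degree \<open>k\<close> in quadratic ones.\<close>

lemma prods_times:
  "m1 \<in> prods S k \<Longrightarrow> m2 \<in> prods T k \<Longrightarrow> m1 * m2 \<in> prods {s * t |s t. s \<in> S \<and> t \<in> T} k"
proof (induction k arbitrary: m1 m2)
  case (Suc k)
  then obtain s n1 t n2 where *: "m1 = s * n1" "s \<in> S" "n1 \<in> prods S k" "m2 = t * n2" "t \<in> T" "n2 \<in> prods T k"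
    by auto
  then have "m1 * m2 = (s * t) * (n1 * n2)" "s * t \<in> {s * t |s t. s \<in> S \<and> t \<in> T}"
    by (auto simp: mult_ac)
  then show ?case
    unfolding prods.simps using Suc.IH[OF *(3,6)] by blast
qed simp

lemma prods_singleton: "m \<in> prods {x} d \<Longrightarrow> m = x ^ d"
  by (induction d arbitrary: m) auto

lemma prods_triple:
  assumes "m \<in> prods {x, y, z} d"
  shows "\<exists>a b c. a + b + c = d \<and> m = x ^ a * y ^ b * z ^ c"
proof -
  have "m \<in> prods ({x} \<union> ({y} \<union> {z})) d"
    using assms by (simp add: insert_commute)
  then obtain a e m1 m2 where *: "a + e = d" "m1 \<in> prods {x} a" "m2 \<in> prods ({y} \<union> {z}) e" "m = m1 * m2"
    by (blast dest: prods_Un)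
  moreover obtain b c n1 n2 where "b + c = e" "n1 \<in> prods {y} b" "n2 \<in> prods {z} c" "m2 = n1 * n2"
    using *(3) by (blast dest: prods_Un)
  ultimately have "a + b + c = d \<and> m = x ^ a * y ^ b * z ^ c"
    by (auto dest!: prods_singleton simp: mult.assoc)
  then show ?thesis
    by blast
qed

lemma prods_eigen:
  assumes "\<And>t. t \<in> S \<Longrightarrow> act g h t = pscale l t"
  shows "m \<in> prods S d \<Longrightarrow> act g h m = pscale (l ^ d) m"
proof (induction d arbitrary: m)
  case (Suc d)
  then obtain t m' where "t \<in> S" "m' \<in> prods S d" "m = t * m'"
    by auto
  then show ?case
    using Suc.IH[of m'] assms[of t] by (simp add: act_hom pscale_mult_left pscale_mult_right mult.commute)
qed simp

text \<open>The averaging principle: \<open>f\<close> equals its own image under a linear map, so it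
  is a combination of the images of the spanning set. The map need not be a projection.\<close>

lemma fixed_in_span:
  assumes "\<And>f g. \<Phi> (f + g) = \<Phi> f + \<Phi> g" "\<And>a f. \<Phi> (pscale a f) = pscale a (\<Phi> f)"
    and "f \<in> poly4.span B" "\<And>b. b \<in> B \<Longrightarrow> \<Phi> b \<in> poly4.span B'" "\<Phi> f = f"
  shows "f \<in> poly4.span B'"
proof -
  have "\<Phi> f \<in> poly4.span B'"
    using assms(3)
  proof (induction rule: poly4.span_induct_alt)
    case base
    then show ?case
      using assms(2)[of 0 0] by (simp add: poly4.span_zero)
  qed (simp add: assms poly4.span_add poly4.span_scale)
  then show ?thesis
    by (simp add: assms)
qed

lemma Const_of_nat: "Const (of_nat n) = of_nat n"
  by (simp add: Const_def)

lemma act_pscale: "act g h (pscale a f) = pscale a (act g h f)"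
  by (simp add: pscale_def act_hom)

text \<open>Averaging over the powers of \<open>act g h\<close> kills the eigenvectors with eigenvalue other than \<open>1\<close>.\<close>

lemma act_fixed_eigen:
  assumes f: "f \<in> poly4.span B" "act g h f = f" and N: "N > 0"
    and B: "\<And>b. b \<in> B \<Longrightarrow> \<exists>l. act g h b = pscale l b \<and> l ^ N = 1 \<and> (l = 1 \<longrightarrow> b \<in> poly4.span B')"
  shows "f \<in> poly4.span B'"
proof -
  \<comment> \<open>The \<open>N\<close>-th power of \<open>act g h\<close> has to be trivial only
    on \<open>B\<close>, where the eigenvalues are \<open>N\<close>-th roots of unity.\<close>
  let ?\<Phi> = "\<lambda>f. pscale (1 / of_nat N) (\<Sum>t<N. (act g h ^^ t) f)"
  have add: "(act g h ^^ t) (f + f') = (act g h ^^ t) f + (act g h ^^ t) f'" for f f' t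
    by (induction t) (simp_all add: act_hom)
  have scale: "(act g h ^^ t) (pscale a f) = pscale a ((act g h ^^ t) f)" for f a t
    by (induction t) (simp_all add: act_pscale)
  show ?thesis
  proof (rule fixed_in_span[where \<Phi> = ?\<Phi>, OF _ _ f(1)])
    show "?\<Phi> (f + f') = ?\<Phi> f + ?\<Phi> f'" for f f'
      by (simp add: add sum.distrib poly4.scale_right_distrib)
    show "?\<Phi> (pscale a f) = pscale a (?\<Phi> f)" for a f
      by (simp add: scale poly4.scale_sum_right poly4.scale_left_commute)
    have "(act g h ^^ t) f = f" for t
      by (induction t) (simp_all add: f)
    then show "?\<Phi> f = f"
      using N by (simp add: pscale_def flip: Const_of_nat mult.assoc Const_mult)
  next
    fix b assume "b \<in> B"
    then obtain l where l: "act g h b = pscale l b" "l ^ N = 1" "l = 1 \<longrightarrow> b \<in> poly4.span B'"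
      using B by blast
    have "(act g h ^^ t) b = pscale (l ^ t) b" for t
      by (induction t) (simp_all add: l act_pscale mult.commute)
    then have *: "?\<Phi> b = pscale ((1 / of_nat N) * (\<Sum>t<N. l ^ t)) b"
      by (simp add: poly4.scale_sum_left[symmetric])
    show "?\<Phi> b \<in> poly4.span B'"
    proof (cases "l = 1")
      case True
      then show ?thesis
        unfolding * using l by (simp add: poly4.span_scale)
    next
      case False
      then have "(\<Sum>t<N. l ^ t) = 0"
        using l(2) by (simp add: geometric_sum)
      then show ?thesis
        unfolding * by (simp add: poly4.span_zero)
    qed
  qed
qed

section \<open>Invariants of the right dihedral factor\<close>

text \<open>With \<open>ZB\<close>, \<open>WW\<close>, \<open>WB\<close> these are the coordinates
  \<open>z\<close>, \<open>w\<close> of \<open>p = z + w j\<close> and their conjugates, as complex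
  linear forms; right multiplication by \<open>qR n\<close> is diagonal in them.\<close>

definition ZZ :: poly4 where "ZZ = X 0 + Const \<i> * X 1"
definition ZB :: poly4 where "ZB = X 0 - Const \<i> * X 1"
definition WW :: poly4 where "WW = X 2 + Const \<i> * X 3"
definition WB :: poly4 where "WB = X 2 - Const \<i> * X 3"

lemma Const_half: "2 * Const (1/2) = 1"
  by (simp flip: Const_mult Const_numeral)

lemma Const_ii: "Const \<i> * Const \<i> = - 1"
  by (simp add: Const_minus flip: Const_mult)

lemma X_in_span_ZW: "range X \<subseteq> poly4.span {ZZ, WB, WW, ZB}"
proof -
  have "X 0 = pscale (1/2) ZZ + pscale (1/2) ZB" "X 2 = pscale (1/2) WW + pscale (1/2) WB"
    "X 1 = pscale (1/2) (pscale \<i> (ZB - ZZ))" "X 3 = pscale (1/2) (pscale \<i> (WB - WW))"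
    unfolding pscale_def ZZ_def ZB_def WW_def WB_def using Const_half Const_ii by algebra+
  moreover have "Z \<in> {ZZ, WB, WW, ZB} \<Longrightarrow> Z \<in> poly4.span {ZZ, WB, WW, ZB}" for Z
    by (rule poly4.span_base)
  ultimately have "X l \<in> poly4.span {ZZ, WB, WW, ZB}" if "l \<in> {0, 1, 2, 3}" for l
    using that by (auto intro!: poly4.span_add poly4.span_diff poly4.span_scale)
  then show ?thesis
    using UNIV_4_from_0 by blast
qed

text \<open>The squared absolute values of \<open>z\<close> and \<open>w\<close> have sum
  \<open>q\<close> and difference \<open>AA\<close>, and \<open>z w\<close> is half of
  \<open>i BB - CC\<close>.\<close>

lemma ZW_products_in_span:
  "{s * t |s t. s \<in> {ZZ, WB} \<and> t \<in> {WW, ZB}} \<subseteq> poly4.span ({q} \<union> {AA, BB, CC})"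
proof -
  have "ZZ * WW = pscale (1/2) (pscale \<i> BB - CC)" "ZZ * ZB = pscale (1/2) (q + AA)"
    "WB * WW = pscale (1/2) (q - AA)" "WB * ZB = pscale (1/2) (- pscale \<i> BB - CC)"
    unfolding pscale_def ZZ_def ZB_def WW_def WB_def AA_def BB_def CC_def q_def
    using Const_half Const_ii by algebra+
  moreover have "f \<in> {q} \<union> {AA, BB, CC} \<Longrightarrow> f \<in> poly4.span ({q} \<union> {AA, BB, CC})" for f
    by (rule poly4.span_base)
  ultimately have "ZZ * WW \<in> poly4.span ({q} \<union> {AA, BB, CC})" "ZZ * ZB \<in> poly4.span ({q} \<union> {AA, BB, CC})"
    "WB * WW \<in> poly4.span ({q} \<union> {AA, BB, CC})" "WB * ZB \<in> poly4.span ({q} \<union> {AA, BB, CC})"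
    by (auto intro!: poly4.span_add poly4.span_diff poly4.span_scale poly4.span_neg)
  then show ?thesis
    by auto
qed

text \<open>With \<open>r = qR n\<close> the substitution sends \<open>p\<close> to
  \<open>p r*\<close>, and \<open>w j r* = w r j\<close>. Hence \<open>w\<close> is multiplied by
  \<open>r\<close>, while \<open>z\<close> is multiplied by its conjugate; the conjugate coordinates
  behave oppositely.\<close>

lemma act_right_qR_ZW:
  assumes "Z \<in> {WW, ZB}"
  shows "act qone (qR n) Z = pscale (cis (pi / n)) Z"
proof -
  have "cis (pi / n) = of_real (cos (pi / n)) + \<i> * of_real (sin (pi / n))"
    by (simp add: complex_eq_iff)
  then have "Const (cis (pi / n)) = rconst (cos (pi / n)) + Const \<i> * rconst (sin (pi / n))"
    by (simp add: Const_hom)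
  then have "act qone (qR n) WW = pscale (cis (pi / n)) WW" "act qone (qR n) ZB = pscale (cis (pi / n)) ZB"
    unfolding pscale_def ZB_def WW_def act_hom act_right_X qR_def quat_nth of_real_0 Const_0 act_Const
    using Const_ii by algebra+
  then show ?thesis
    using assms by blast
qed

lemma act_right_qR_ZW':
  assumes "Z \<in> {ZZ, WB}"
  shows "act qone (qR n) Z = pscale (cis (- (pi / n))) Z"
proof -
  have "cis (- (pi / n)) = of_real (cos (pi / n)) - \<i> * of_real (sin (pi / n))"
    by (simp add: complex_eq_iff)
  then have "Const (cis (- (pi / n))) = rconst (cos (pi / n)) - Const \<i> * rconst (sin (pi / n))"
    by (simp add: Const_hom)
  then have "act qone (qR n) ZZ = pscale (cis (- (pi / n))) ZZ" "act qone (qR n) WB = pscale (cis (- (pi / n))) WB"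
    unfolding pscale_def ZZ_def WB_def act_hom act_right_X qR_def quat_nth of_real_0 Const_0 act_Const
    using Const_ii by algebra+
  then show ?thesis
    using assms by blast
qed

lemma cis_pi_eq_1:
  assumes "cis (of_int m * pi / n) = 1" "\<bar>m\<bar> < 2 * int n" "n > 0"
  shows "m = 0"
proof -
  have "cos (of_int m * pi / n) = 1"
    using assms(1) by (simp add: complex_eq_iff)
  then obtain x :: int where "of_int m * pi / n = of_int x * 2 * pi"
    using cos_one_2pi_int by blast
  then have "real_of_int m = real_of_int (2 * int n * x)"
    using assms(3) by (simp add: field_simps)
  then have "m = 2 * int n * x"
    by (simp only: of_int_eq_iff)
  then show ?thesis
    using assms(2,3) by (cases "x = 0") (auto simp: abs_mult)
qed

lemma right_rotation_invariants:
  assumes f: "homogeneous (2 * k) f" "act qone (qR n) f = f" and "k < n"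
  shows "f \<in> poly4.span (prods ({q} \<union> {AA, BB, CC}) k)"
proof -
  let ?S = "{ZZ, WB}" and ?T = "{WW, ZB}"
  have n: "n > 0" using assms by simp
  have "f \<in> poly4.span (prods (?S \<union> ?T) (2 * k))"
    using homogeneous_in_span[OF f(1)] span_prods_mono[OF X_in_span_ZW] by (auto simp: insert_commute)
  then have "f \<in> poly4.span (prods {s * t |s t. s \<in> ?S \<and> t \<in> ?T} k)"
  proof (rule act_fixed_eigen[OF _ f(2)])
    \<comment> \<open>The number of averaged powers is the order \<open>2 * n\<close> of
      \<open>qR n\<close>.\<close>
    show "2 * n > 0"
      using n by simp
  next
    fix b assume "b \<in> prods (?S \<union> ?T) (2 * k)"
    then obtain i j m1 m2 where *: "i + j = 2 * k" "m1 \<in> prods ?S i" "m2 \<in> prods ?T j" "b = m1 * m2"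
      by (blast dest: prods_Un)
    let ?l = "cis (of_int (int j - int i) * pi / n)"
    have "?l = cis (- (pi / n)) ^ i * cis (pi / n) ^ j"
      unfolding Complex.DeMoivre cis_mult by (simp add: field_simps diff_divide_distrib)
    then have "act qone (qR n) b = pscale ?l b"
      using prods_eigen[OF act_right_qR_ZW' *(2)] prods_eigen[OF act_right_qR_ZW *(3)]
      by (simp add: * act_hom pscale_mult_left pscale_mult_right)
    moreover have "?l ^ (2 * n) = 1"
    proof -
      have "real (2 * n) * (of_int (int j - int i) * pi / n) = 2 * pi * of_int (int j - int i)"
        using n by simp
      then have "?l ^ (2 * n) = cis (2 * pi * of_int (int j - int i))"
        unfolding Complex.DeMoivre by (rule arg_cong)
      also have "\<dots> = 1"
        by (rule cis_multiple_2pi) simp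
      finally show ?thesis .
    qed
    moreover have "b \<in> poly4.span (prods {s * t |s t. s \<in> ?S \<and> t \<in> ?T} k)" if "?l = 1"
    proof -
      \<comment> \<open>The weight \<open>j - i\<close> is at most \<open>2 * k < 2 * n\<close> in
        absolute value, so a trivial eigenvalue forces weight zero.\<close>
      have "int j - int i = 0"
        using * \<open>k < n\<close> by (intro cis_pi_eq_1[OF that]) auto
      then have "i = k" "j = k"
        using * by auto
      then show ?thesis
        using *(2-4) by (simp only:) (intro poly4.span_base prods_times)
    qed
    ultimately show "\<exists>l. act qone (qR n) b = pscale l b \<and> l ^ (2 * n) = 1 \<and>
        (l = 1 \<longrightarrow> b \<in> poly4.span (prods {s * t |s t. s \<in> ?S \<and> t \<in> ?T} k))"
      by blast
  qed
  then show ?thesis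
    using span_prods_mono[OF ZW_products_in_span] by blast
qed

lemma norm_qj: "norm qj = 1"
  using norm_quat_sq[of qj] by (simp add: qj_def power2_eq_1_iff) (smt (verit) norm_ge_zero)

lemma right_dihedral_invariants:
  assumes f: "homogeneous (2 * k) f" "act qone (qR n) f = f" "act qone qj f = f" and "k < n" "even k"
  shows "f \<in> poly4.span (prods {AA, BB, CC} k)"
proof (rule act_fixed_eigen[OF right_rotation_invariants[OF f(1,2) \<open>k < n\<close>] f(3)])
  show "(2 :: nat) > 0" by simp
next
  fix b assume "b \<in> prods ({q} \<union> {AA, BB, CC}) k"
  then obtain i j m where *: "i + j = k" "m \<in> prods {AA, BB, CC} j" "b = q ^ i * m"
    by (blast dest: prods_Un prods_singleton)
  have "act qone qj m = pscale ((- 1) ^ j) m"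
    using *(2) by (rule prods_eigen[rotated]) (auto simp: act_right_qj pscale_def Const_minus)
  then have "act qone qj b = pscale ((- 1) ^ j) b"
    by (simp add: * act_hom act_right_q norm_qj pscale_mult_right)
  moreover have "((- 1) ^ j) ^ 2 = (1 :: complex)"
    by (simp flip: power_mult)
  moreover have "b \<in> poly4.span (prods {AA, BB, CC} k)" if "(- 1) ^ j = (1 :: complex)"
  proof -
    have "even j"
      using that by (metis minus_one_power_iff one_neq_neg_one)
    \<comment> \<open>Parity of \<open>i = k - j\<close> is what allows the power of
      \<open>q\<close> to be rewritten through \<open>q_sq\<close>.\<close>
    then have "even i"
      using * \<open>even k\<close> by auto
    have "q ^ 2 \<in> poly4.span (prods {AA, BB, CC} 2)"
      unfolding q_sq by (intro poly4.span_add poly4.span_base prods_power) auto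
    then have "(q ^ 2) ^ (i div 2) \<in> poly4.span (prods {AA, BB, CC} (i div 2 * 2))"
      by (rule span_prods_power)
    then have "q ^ i \<in> poly4.span (prods {AA, BB, CC} i)"
      using \<open>even i\<close> by (simp flip: power_mult)
    from span_prods_mult[OF this poly4.span_base[OF *(2)]] show ?thesis
      by (simp add: *)
  qed
  ultimately show "\<exists>l. act qone qj b = pscale l b \<and> l ^ 2 = 1 \<and> (l = 1 \<longrightarrow> b \<in> poly4.span (prods {AA, BB, CC} k))"
    by blast
qed

section \<open>Invariants of the left factor\<close>

lemma act_left_qi: "act qi qone AA = AA" "act qi qone BB = - BB" "act qi qone CC = - CC"
  by (simp_all add: act_left_AA act_left_BB act_left_CC qi_def Const_minus)

lemma act_left_qj: "act qj qone AA = - AA" "act qj qone BB = BB" "act qj qone CC = - CC"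
  by (simp_all add: act_left_AA act_left_BB act_left_CC qj_def Const_minus)

text \<open>\<open>qS\<close> has real part 1/2, so this is a third of a turn. The signs disappear
  on the squares, which are permuted cyclically.\<close>

lemma act_left_qS: "act qS qone AA = - BB" "act qS qone BB = - CC" "act qS qone CC = AA"
  by (simp_all add: act_left_AA act_left_BB act_left_CC qS_def Const_minus power2_eq_square)

lemma act_left_qR:
  "act (qR n) qone AA = AA"
  "act (qR n) qone BB = rconst (cos (2 * (pi / n))) * BB - rconst (sin (2 * (pi / n))) * CC"
  "act (qR n) qone CC = rconst (sin (2 * (pi / n))) * BB + rconst (cos (2 * (pi / n))) * CC"
proof -
  let ?t = "pi / real n"
  have "(cos ?t)\<^sup>2 - (sin ?t)\<^sup>2 = cos (2 * ?t)" "2 * (cos ?t * sin ?t) = sin (2 * ?t)"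
    by (simp_all only: cos_double sin_double mult_ac)
  then show "act (qR n) qone AA = AA"
    "act (qR n) qone BB = rconst (cos (2 * ?t)) * BB - rconst (sin (2 * ?t)) * CC"
    "act (qR n) qone CC = rconst (sin (2 * ?t)) * BB + rconst (cos (2 * ?t)) * CC"
    by (simp_all add: act_left_AA act_left_BB act_left_CC qR_def Const_minus
        del: of_real_diff of_real_mult of_real_power times_divide_eq_right)
qed

text \<open>The half turn \<open>qi\<close> leaves only monomials with \<open>b + c\<close> even,
  then \<open>qj\<close> only those with \<open>a + c\<close> even; since the total degree is even,
  all three exponents are even.\<close>

lemma even_left_invariants:
  assumes f: "f \<in> poly4.span (prods {AA, BB, CC} k)" "act qi qone f = f" "act qj qone f = f" and "even k"
  shows "f \<in> poly4.span (prods {AA ^ 2, BB ^ 2, CC ^ 2} (k div 2))"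
proof -
  let ?B = "{AA ^ a * BB ^ b * CC ^ c |a b c. a + b + c = k \<and> even (b + c)}"
  have neg: "(- x) ^ m = pscale ((- 1) ^ m) (x ^ m)" for x :: poly4 and m
    by (simp add: pscale_def Const_hom flip: power_mult_distrib)
  have "f \<in> poly4.span ?B"
  proof (rule act_fixed_eigen[OF f(1,2)])
    show "(2 :: nat) > 0" by simp
  next
    fix m assume "m \<in> prods {AA, BB, CC} k"
    then obtain a b c where *: "a + b + c = k" "m = AA ^ a * BB ^ b * CC ^ c"
      by (blast dest: prods_triple)
    have "act qi qone m = pscale ((- 1) ^ (b + c)) m"
      by (simp add: * act_hom act_left_qi neg pscale_mult_left pscale_mult_right power_add mult_ac)
    moreover have "((- 1) ^ (b + c)) ^ 2 = (1 :: complex)"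
      by (simp flip: power_mult)
    moreover have "m \<in> poly4.span ?B" if "(- 1) ^ (b + c) = (1 :: complex)"
    proof -
      have "even (b + c)"
        using that by (metis minus_one_power_iff one_neq_neg_one)
      then show ?thesis
        using * by (intro poly4.span_base) blast
    qed
    ultimately show "\<exists>l. act qi qone m = pscale l m \<and> l ^ 2 = 1 \<and> (l = 1 \<longrightarrow> m \<in> poly4.span ?B)"
      by blast
  qed
  then show ?thesis
  proof (rule act_fixed_eigen[OF _ f(3)])
    show "(2 :: nat) > 0" by simp
  next
    let ?B' = "prods {AA ^ 2, BB ^ 2, CC ^ 2} (k div 2)"
    fix m assume "m \<in> ?B"
    then obtain a b c where *: "a + b + c = k" "even (b + c)" "m = AA ^ a * BB ^ b * CC ^ c"
      by blast
    have "act qj qone m = pscale ((- 1) ^ (a + c)) m"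
      by (simp add: * act_hom act_left_qj neg pscale_mult_left pscale_mult_right power_add mult_ac)
    moreover have "((- 1) ^ (a + c)) ^ 2 = (1 :: complex)"
      by (simp flip: power_mult)
    moreover have "m \<in> poly4.span ?B'" if "(- 1) ^ (a + c) = (1 :: complex)"
    proof -
      have "even (a + c)"
        using that by (metis minus_one_power_iff one_neq_neg_one)
      then have "even a" "even b" "even c"
        using * \<open>even k\<close> by auto
      then obtain a' b' c' where e: "a = 2 * a'" "b = 2 * b'" "c = 2 * c'"
        by (elim evenE)
      have "(AA ^ 2) ^ a' * ((BB ^ 2) ^ b' * (CC ^ 2) ^ c') \<in> prods {AA ^ 2, BB ^ 2, CC ^ 2} (a' + (b' + c'))"
        by (intro prods_mult prods_power) auto
      also have "a' + (b' + c') = k div 2"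
        using * e by auto
      finally show ?thesis
        unfolding * e power_mult mult.assoc by (rule poly4.span_base)
    qed
    ultimately show "\<exists>l. act qj qone m = pscale l m \<and> l ^ 2 = 1 \<and> (l = 1 \<longrightarrow> m \<in> poly4.span ?B')"
      by blast
  qed
qed

section \<open>Degree 4 under the left dihedral factor\<close>

lemma f23_eq: "BB ^ 2 + CC ^ 2 = 2 * (f2 + f3)"
  unfolding f2_def f3_def BB_def CC_def by algebra

lemma prods_1: "prods T 1 = T"
  by auto

text \<open>\<open>qR n\<close> rotates the \<open>BB\<close>, \<open>CC\<close> plane. Of the
  quadratic monomials in its eigenforms only the product of the two is fixed, and it equals
  \<open>BB ^ 2 + CC ^ 2\<close>; \<open>AA ^ 2\<close> is the complement of this in
  \<open>q ^ 2\<close>.\<close>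

lemma left_dihedral_degree_4:
  assumes f: "f \<in> poly4.span (prods {AA ^ 2, BB ^ 2, CC ^ 2} 1)" "act (qR n) qone f = f" and "n \<ge> 3"
  shows "f \<in> poly4.span {q ^ 2, f2 + f3}"
proof -
  define P M where "P = BB + Const \<i> * CC" and "M = BB - Const \<i> * CC"
  let ?l = "cis (2 * (pi / n))" and ?l' = "cis (- (2 * (pi / n)))"
  have "?l = of_real (cos (2 * (pi / n))) + \<i> * of_real (sin (2 * (pi / n)))"
    by (simp add: complex_eq_iff)
  then have "Const ?l = rconst (cos (2 * (pi / n))) + Const \<i> * rconst (sin (2 * (pi / n)))"
    by (simp only: Const_hom)
  then have P: "act (qR n) qone P = pscale ?l P"
    unfolding pscale_def P_def act_hom act_left_qR act_Const using Const_ii by algebra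
  have "?l' = of_real (cos (2 * (pi / n))) - \<i> * of_real (sin (2 * (pi / n)))"
    by (simp add: complex_eq_iff)
  then have "Const ?l' = rconst (cos (2 * (pi / n))) - Const \<i> * rconst (sin (2 * (pi / n)))"
    by (simp only: Const_hom)
  then have M: "act (qR n) qone M = pscale ?l' M"
    unfolding pscale_def M_def act_hom act_left_qR act_Const using Const_ii by algebra
  have ll: "?l * ?l' = 1"
    by (simp add: cis_mult)
  have lN: "?l ^ n = 1" "?l' ^ n = 1"
  proof -
    show "?l ^ n = 1"
      using \<open>n \<ge> 3\<close> by (simp add: Complex.DeMoivre)
    then show "?l' ^ n = 1"
      using ll by (metis mult_1 power_mult_distrib power_one)
  qed
  \<comment> \<open>The square is \<open>cis (4 * pi / n)\<close>, and 4 lies strictly between 0 and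
    \<open>2 * n\<close> because \<open>n >= 3\<close>.\<close>
  have l2: "?l ^ 2 \<noteq> 1"
  proof
    assume "?l ^ 2 = 1"
    then have "cis (of_int 4 * pi / n) = 1"
      by (simp add: Complex.DeMoivre)
    from cis_pi_eq_1[OF this] \<open>n \<ge> 3\<close> show False
      by simp
  qed
  then have l'2: "?l' ^ 2 \<noteq> 1"
    using ll by (metis mult_1_right power_mult_distrib power_one)
  have "BB ^ 2 = pscale (1/2) (pscale (1/2) (P ^ 2 + M ^ 2 + pscale 2 (P * M)))"
    "CC ^ 2 = pscale (1/2) (pscale (1/2) (pscale 2 (P * M) - P ^ 2 - M ^ 2))"
    unfolding P_def M_def pscale_def Const_numeral using Const_half Const_ii by algebra+
  moreover have "x \<in> {AA ^ 2, P ^ 2, M ^ 2, P * M} \<Longrightarrow> x \<in> poly4.span {AA ^ 2, P ^ 2, M ^ 2, P * M}" for x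
    by (rule poly4.span_base)
  ultimately have "{AA ^ 2, BB ^ 2, CC ^ 2} \<subseteq> poly4.span {AA ^ 2, P ^ 2, M ^ 2, P * M}"
    by (auto intro!: poly4.span_add poly4.span_diff poly4.span_scale)
  then have "f \<in> poly4.span {AA ^ 2, P ^ 2, M ^ 2, P * M}"
    using f(1) poly4.span_minimal[OF _ poly4.subspace_span] by (auto simp only: prods_1)
  then show ?thesis
  proof (rule act_fixed_eigen[OF _ f(2)])
    show "n > 0"
      using \<open>n \<ge> 3\<close> by simp
  next
    let ?V = "poly4.span {q ^ 2, f2 + f3}"
    have V: "q ^ 2 \<in> ?V" "f2 + f3 \<in> ?V"
      by (auto intro: poly4.span_base)
    have "P * M = 2 * (f2 + f3)"
      unfolding f23_eq[symmetric] P_def M_def using Const_ii by algebra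
    then have PM: "P * M = pscale 2 (f2 + f3)" "AA ^ 2 = q ^ 2 - P * M"
      using q_sq f23_eq unfolding pscale_def Const_numeral by algebra+
    then have "P * M \<in> ?V" "AA ^ 2 \<in> ?V"
      using V by (auto intro!: poly4.span_scale poly4.span_diff simp del: poly4.scale_right_distrib)
    fix b assume "b \<in> {AA ^ 2, P ^ 2, M ^ 2, P * M}"
    moreover have "act (qR n) qone (AA ^ 2) = pscale 1 (AA ^ 2)"
      by (simp add: act_hom act_left_qR)
    moreover have "act (qR n) qone (P * M) = pscale 1 (P * M)"
      by (simp add: act_hom P M pscale_mult_left pscale_mult_right cis_mult)
    moreover have "act (qR n) qone (P ^ 2) = pscale (?l ^ 2) (P ^ 2)"
      by (simp add: act_hom P pscale_mult_left pscale_mult_right power2_eq_square)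
    moreover have "act (qR n) qone (M ^ 2) = pscale (?l' ^ 2) (M ^ 2)"
      by (simp add: act_hom M pscale_mult_left pscale_mult_right power2_eq_square)
    moreover have "(?l ^ 2) ^ n = 1" "(?l' ^ 2) ^ n = 1"
      using lN by (metis power_mult mult.commute power_one)+
    ultimately show "\<exists>l. act (qR n) qone b = pscale l b \<and> l ^ n = 1 \<and> (l = 1 \<longrightarrow> b \<in> ?V)"
      using l2 l'2 \<open>P * M \<in> ?V\<close> \<open>AA ^ 2 \<in> ?V\<close> by (elim insertE emptyE) (blast intro: power_one)+
  qed
qed

section \<open>Degree 8 under the tetrahedral factor\<close>

lemma P8_eq: "P8 = (AA ^ 2 - (BB + CC) ^ 2) * (AA ^ 2 - (BB - CC) ^ 2)"
proof -
  have "{0..3::nat} = {0, 1, 2, 3}"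
    by auto
  then have "P8 = K8 0 * (K8 1 * (K8 2 * K8 3))"
    by (simp add: P8_def)
  \<comment> \<open>Factors 2, 3 and factors 0, 1 each multiply to a difference of two
    squares.\<close>
  moreover have "K8 0 = AA + BB - CC" "K8 1 = AA - BB + CC" "K8 2 = AA - BB - CC" "K8 3 = AA + BB + CC"
    unfolding K8_def AA_def BB_def CC_def by (simp_all add: Let_def algebra_simps)
  ultimately show ?thesis
    by algebra
qed

text \<open>\<open>qS\<close> permutes the monomials in the squares instead of scaling them, so here
  the average is controlled by orbit sums rather than by eigenvalues.\<close>

lemma left_qS_average:
  assumes f: "f \<in> poly4.span B" "act qS qone f = f"
    and B: "\<And>b. b \<in> B \<Longrightarrow> b + act qS qone b + act qS qone (act qS qone b) \<in> poly4.span B'"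
  shows "f \<in> poly4.span B'"
proof (rule fixed_in_span[where \<Phi> = "\<lambda>f. pscale (1/3) (f + act qS qone f + act qS qone (act qS qone f))", OF _ _ f(1)])
  have "f + f + f = pscale 3 f"
    by (simp add: pscale_def Const_numeral)
  then show "pscale (1/3) (f + act qS qone f + act qS qone (act qS qone f)) = f"
    by (simp add: f(2))
qed (simp_all add: act_pscale poly4.scale_left_commute B poly4.span_scale act_hom(1) del: poly4.scale_right_distrib,
    simp_all add: poly4.scale_right_distrib poly4.scale_left_commute ac_simps)

text \<open>In degree 2 the cyclic sums in the squares \<open>a, b, c\<close> are already symmetric:
  the sum of squares \<open>e\<close> and the sum of products \<open>h\<close>. Since
  \<open>q ^ 4 = e + 2 h\<close> and \<open>P8 = e - 2 h\<close>, both sums can be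
  recovered.\<close>

lemma left_tetrahedral_degree_8:
  assumes f: "f \<in> poly4.span (prods {AA ^ 2, BB ^ 2, CC ^ 2} 2)" "act qS qone f = f"
  shows "f \<in> poly4.span {q ^ 4, P8}"
proof (rule left_qS_average[OF f])
  let ?V = "poly4.span {q ^ 4, P8}"
  define a b c where "a = AA ^ 2" and "b = BB ^ 2" and "c = CC ^ 2"
  have act: "act qS qone a = b" "act qS qone b = c" "act qS qone c = a"
    by (simp_all add: a_def b_def c_def act_hom act_left_qS)
  have V: "q ^ 4 \<in> ?V" "P8 \<in> ?V"
    by (auto intro: poly4.span_base)
  have "q ^ 4 = (a + b + c) ^ 2"
    unfolding a_def b_def c_def q_sq[symmetric] by simp
  moreover have "P8 = a ^ 2 + b ^ 2 + c ^ 2 - 2 * (a * b + b * c + c * a)"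
    unfolding P8_eq a_def b_def c_def by algebra
  ultimately have "a ^ 2 + b ^ 2 + c ^ 2 = pscale (1/2) (q ^ 4 + P8)"
    "a * b + b * c + c * a = pscale (1/2) (pscale (1/2) (q ^ 4 - P8))"
    unfolding pscale_def using Const_half by algebra+
  then have s: "a ^ 2 + b ^ 2 + c ^ 2 \<in> ?V" "a * b + b * c + c * a \<in> ?V"
    using V by (auto intro!: poly4.span_add poly4.span_diff poly4.span_scale)
  fix m assume "m \<in> prods {AA ^ 2, BB ^ 2, CC ^ 2} 2"
  then have "m \<in> {a ^ 2, b ^ 2, c ^ 2, a * b, b * c, c * a}"
    by (auto simp: numeral_2_eq_2 a_def b_def c_def mult_ac)
  then show "m + act qS qone m + act qS qone (act qS qone m) \<in> ?V"
    using s by (elim insertE emptyE) (simp_all add: act_hom act add_ac mult_ac)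
qed

section \<open>The icosahedral case\<close>

lemma golden_sq: "golden * golden = golden + 1"
proof -
  have "sqrt 5 * sqrt 5 = 5"
    by simp
  then show ?thesis
    unfolding golden_def by (simp add: field_simps)
qed

lemma golden_pos: "golden > 0"
  by (simp add: golden_def add_pos_nonneg)

lemma tau_sq: "tau * tau = tau + 1"
  unfolding tau_def by (metis Const_1 Const_add Const_mult golden_sq of_real_1 of_real_add of_real_mult)

lemma Const_half_real: "rconst (1/2) = Const (1/2)"
  by simp

lemma act_left_qU:
  "act qU qone AA = Const (1/2) * ((tau - 1) * AA - tau * BB + CC)"
  "act qU qone BB = Const (1/2) * (tau * AA + BB + (tau - 1) * CC)"
  "act qU qone CC = Const (1/2) * (- AA + (tau - 1) * BB + tau * CC)"
proof -
  have g: "golden\<^sup>2 = golden + 1"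
    by (simp add: golden_sq power2_eq_square)
  \<comment> \<open>The left sides are the rotation coefficients at the coordinates of
    \<open>qU\<close>; the quadratic relation of \<open>golden\<close> makes them linear in
    it.\<close>
  have 1: "(golden / 2)\<^sup>2 + 0\<^sup>2 - ((golden - 1) / 2)\<^sup>2 - (1/2)\<^sup>2 = 1/2 * (golden - 1)"
    "2 * (0 * ((golden - 1) / 2) - golden / 2 * (1/2)) = 1/2 * - golden"
    "2 * (0 * (1/2) + golden / 2 * ((golden - 1) / 2)) = 1/2"
    "2 * (0 * ((golden - 1) / 2) + golden / 2 * (1/2)) = 1/2 * golden"
    "(golden / 2)\<^sup>2 - 0\<^sup>2 + ((golden - 1) / 2)\<^sup>2 - (1/2)\<^sup>2 = 1/2"
    "2 * ((golden - 1) / 2 * (1/2) - golden / 2 * 0) = 1/2 * (golden - 1)"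
    "2 * (0 * (1/2) - golden / 2 * ((golden - 1) / 2)) = 1/2 * -1"
    "2 * ((golden - 1) / 2 * (1/2) + golden / 2 * 0) = 1/2 * (golden - 1)"
    "(golden / 2)\<^sup>2 - 0\<^sup>2 - ((golden - 1) / 2)\<^sup>2 + (1/2)\<^sup>2 = 1/2 * golden"
    by (simp_all add: power_divide power2_diff g golden_sq field_simps)
  show "act qU qone AA = Const (1/2) * ((tau - 1) * AA - tau * BB + CC)"
    "act qU qone BB = Const (1/2) * (tau * AA + BB + (tau - 1) * CC)"
    "act qU qone CC = Const (1/2) * (- AA + (tau - 1) * BB + tau * CC)"
    unfolding act_left_AA act_left_BB act_left_CC qU_def quat_nth 1
    unfolding tau_def of_real_mult of_real_minus of_real_diff of_real_1 Const_mult Const_minus Const_diff Const_1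
      Const_half_real
    by algebra+
qed

text \<open>\<open>CC\<close> contains \<open>x0 x2 - x1 x3\<close> with a minus sign, which turns
  \<open>1 - tau\<close> into \<open>tau - 1\<close>, the inverse of \<open>tau\<close>. The signs
  of the last two factors cancel.\<close>

lemma P12_factors: "P12 =
  (AA + (tau - 1) * CC) * (AA + tau * BB) * (AA - (tau - 1) * CC) * (AA - tau * BB)
    * (CC + (tau - 1) * BB) * (CC - (tau - 1) * BB)"
proof -
  have "{0..5::nat} = {0, 1, 2, 3, 4, 5}"
    by auto
  then have "P12 = K12 0 * (K12 1 * (K12 2 * (K12 3 * (K12 4 * K12 5))))"
    by (simp add: P12_def)
  moreover have "K12 0 = AA + (tau - 1) * CC" "K12 1 = AA + tau * BB" "K12 2 = AA - (tau - 1) * CC"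
    "K12 3 = AA - tau * BB" "K12 4 = - (CC + (tau - 1) * BB)" "K12 5 = - (CC - (tau - 1) * BB)"
    unfolding K12_def AA_def BB_def CC_def by (simp_all add: algebra_simps power2_eq_square)
  ultimately show ?thesis
    by algebra
qed

lemma act_tau [simp]: "act g h tau = tau"
  by (simp add: tau_def)

text \<open>\<open>qU\<close> is a fifth of a turn about one of the six axes: it fixes the factor
  \<open>CC + (tau - 1) * BB\<close> and cycles the other five up to scalars, whose product
  \<open>(tau - 1) * tau\<close> is 1.\<close>

lemma act_qU_P12: "act qU qone P12 = P12"
proof -
  let ?s = "tau - 1"
  have *: "act qU qone (AA + ?s * CC) = CC - ?s * BB"
    "act qU qone (AA - ?s * CC) = ?s * (AA - tau * BB)"
    "act qU qone (AA + tau * BB) = tau * (AA + ?s * CC)"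
    "act qU qone (AA - tau * BB) = - (AA + tau * BB)"
    "act qU qone (CC + ?s * BB) = CC + ?s * BB"
    "act qU qone (CC - ?s * BB) = - (AA - ?s * CC)"
    unfolding act_hom act_left_qU act_tau act_1 using tau_sq Const_half by algebra+
  have "act qU qone P12 = (?s * tau) * P12"
    unfolding P12_factors act_hom(2) * by algebra
  then show ?thesis
    using tau_sq by (simp add: algebra_simps)
qed

lemma P12_sq_eq: "P12 = (AA ^ 2 - (tau - 1) ^ 2 * CC ^ 2) * (AA ^ 2 - tau ^ 2 * BB ^ 2) * (CC ^ 2 - (tau - 1) ^ 2 * BB ^ 2)"
  unfolding P12_factors by algebra

lemma act_qS_P12: "act qS qone P12 = P12"
proof -
  \<comment> \<open>After the cyclic shift of the squares, the three factors of
    \<open>P12_sq_eq\<close> reappear permuted, up to scalars with product 1.\<close>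
  have 1: "(BB ^ 2 - tau ^ 2 * CC ^ 2) = - (tau ^ 2) * (CC ^ 2 - (tau - 1) ^ 2 * BB ^ 2)"
    "(BB ^ 2 - (tau - 1) ^ 2 * AA ^ 2) = - ((tau - 1) ^ 2) * (AA ^ 2 - tau ^ 2 * BB ^ 2)"
    "tau ^ 2 * (tau - 1) ^ 2 = 1"
    using tau_sq by algebra+
  have "act qS qone P12 = (BB ^ 2 - (tau - 1) ^ 2 * AA ^ 2) * (BB ^ 2 - tau ^ 2 * CC ^ 2) * (AA ^ 2 - (tau - 1) ^ 2 * CC ^ 2)"
    by (simp add: P12_sq_eq act_hom act_left_qS)
  also have "\<dots> = (tau ^ 2 * (tau - 1) ^ 2) * P12"
    unfolding 1(1,2) P12_sq_eq by (simp only: ac_simps mult_minus_left mult_minus_right minus_minus)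
  finally show ?thesis
    by (simp add: 1)
qed

lemma act_qi_P12: "act qi qone P12 = P12"
  by (simp add: P12_sq_eq act_hom act_left_qi)

lemma norm_eq_1: "(p $ 0)\<^sup>2 + (p $ 1)\<^sup>2 + (p $ 2)\<^sup>2 + (p $ 3)\<^sup>2 = 1 \<Longrightarrow> norm (p :: quat) = 1"
  using norm_quat_sq[of p] norm_ge_zero[of p] by (simp add: power2_eq_1_iff)

lemma norm_qU: "norm qU = 1"
  by (rule norm_eq_1) (simp add: qU_def power_divide power2_diff power2_eq_square golden_sq field_simps)

lemma eval_ABC:
  "eval.insertion x AA = (x 0)\<^sup>2 + (x 1)\<^sup>2 - (x 2)\<^sup>2 - (x 3)\<^sup>2"
  "eval.insertion x BB = 2 * (x 0 * x 3 + x 1 * x 2)"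
  "eval.insertion x CC = 2 * (x 1 * x 3 - x 0 * x 2)"
  by (simp_all add: AA_def BB_def CC_def eval.insertion_hom)

lemma eval_tau: "eval.insertion x tau = of_real golden"
  by (simp add: tau_def)

lemma left_icosahedral_degree_12:
  assumes f: "f \<in> poly4.span (prods {AA ^ 2, BB ^ 2, CC ^ 2} 3)" "act qS qone f = f" "act qU qone f = f"
  shows "f \<in> poly4.span {q ^ 6, P12}"
proof -
  define a b c where "a = AA ^ 2" and "b = BB ^ 2" and "c = CC ^ 2"
  define s1 s2 s3 s4 where "s1 = a ^ 3 + b ^ 3 + c ^ 3" and "s2 = a ^ 2 * b + b ^ 2 * c + c ^ 2 * a"
    and "s3 = a ^ 2 * c + b ^ 2 * a + c ^ 2 * b" and "s4 = a * b * c"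
  have "f \<in> poly4.span {s1, s2, s3, s4}"
  proof (rule left_qS_average[OF f(1,2)])
    let ?V = "poly4.span {s1, s2, s3, s4}"
    have act: "act qS qone a = b" "act qS qone b = c" "act qS qone c = a"
      by (simp_all add: a_def b_def c_def act_hom act_left_qS)
    have V: "s1 \<in> ?V" "s2 \<in> ?V" "s3 \<in> ?V" "s4 \<in> ?V"
      by (auto intro: poly4.span_base)
    fix m assume "m \<in> prods {AA ^ 2, BB ^ 2, CC ^ 2} 3"
    then have "m \<in> {a ^ 3, b ^ 3, c ^ 3, a ^ 2 * b, b ^ 2 * c, c ^ 2 * a, a ^ 2 * c, b ^ 2 * a, c ^ 2 * b, a * b * c}"
      unfolding a_def[symmetric] b_def[symmetric] c_def[symmetric]
      by (auto simp: numeral_3_eq_3 numeral_2_eq_2 mult_ac)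
    \<comment> \<open>The monomial \<open>a * b * c\<close> is fixed and is counted three times; the
      others run through orbits of length three.\<close>
    then have "m + act qS qone m + act qS qone (act qS qone m) \<in> {s1, s2, s3, pscale 3 s4}"
      by (elim insertE emptyE)
        (simp_all add: act_hom act s1_def s2_def s3_def s4_def pscale_def Const_numeral add_ac mult_ac)
    then show "m + act qS qone m + act qS qone (act qS qone m) \<in> ?V"
      using V by (auto intro: poly4.span_scale)
  qed
  then obtain c1 c2 c3 c4 where fc: "f = pscale c1 s1 + pscale c2 s2 + pscale c3 s3 + pscale c4 s4"
    by (auto simp: poly4.span_breakdown_eq algebra_simps)
  define t where "t = complex_of_real golden"
  have tt: "t * t = t + 1"
    unfolding t_def using golden_sq by (metis of_real_1 of_real_add of_real_mult)
  \<comment> \<open>Subtracting multiples of \<open>q ^ 6\<close> and \<open>P12\<close> from \<open>f\<close> removes \<open>s1\<close> and \<open>s3\<close>; what remains of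
      \<open>s2\<close> and \<open>s4\<close> must vanish.\<close>
  define d2 d4 where "d2 = c2 - 3 * c1 + (t - 1) ^ 2 * (c3 - 3 * c1)"
    and "d4 = c4 - 6 * c1 - ((t - 1) ^ 4 - t ^ 2) * (c3 - 3 * c1)"
  have "q ^ 6 = (a + b + c) ^ 3"
    unfolding a_def b_def c_def q_sq[symmetric] by simp
  then have q6: "q ^ 6 = s1 + 3 * s2 + 3 * s3 + 6 * s4"
    unfolding s1_def s2_def s3_def s4_def by algebra
  have P12: "P12 = s3 - (tau - 1) ^ 2 * s2 + ((tau - 1) ^ 4 - tau ^ 2) * s4"
    unfolding P12_sq_eq s2_def s3_def s4_def a_def[symmetric] b_def[symmetric] c_def[symmetric]
    using tau_sq by algebra
  have f_eq: "f = pscale c1 (q ^ 6) + pscale (c3 - 3 * c1) P12 + (pscale d2 s2 + pscale d4 s4)"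
    unfolding fc q6 P12 d2_def d4_def pscale_def Const_hom tau_def t_def[symmetric] Const_1
    by algebra
  define g where "g = pscale d2 s2 + pscale d4 s4"
  have "act qU qone (q ^ 6) = q ^ 6"
    by (simp add: act_hom act_left_q norm_qU)
  then have "act qU qone g = g"
    using f(3) unfolding f_eq g_def[symmetric] by (simp add: act_hom(1) act_pscale act_qU_P12)
  then have ev: "eval.insertion x (act qU qone g) = eval.insertion x g" for x
    by simp
  \<comment> \<open>\<open>F A B C\<close> is the value of \<open>g\<close> at a point where
    \<open>AA\<close>, \<open>BB\<close>, \<open>CC\<close> take the values \<open>A\<close>,
    \<open>B\<close>, \<open>C\<close>. The next fact expresses invariance under \<open>qU\<close>
    in these coordinates.\<close>
  define F where "F A B C = d2 * ((A\<^sup>2)\<^sup>2 * B\<^sup>2 + (B\<^sup>2)\<^sup>2 * C\<^sup>2 + (C\<^sup>2)\<^sup>2 * A\<^sup>2) + d4 * (A\<^sup>2 * B\<^sup>2 * C\<^sup>2)"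
    for A B C :: complex
  have F: "F A' B' C' = F A B C"
    if "A = eval.insertion x AA" "B = eval.insertion x BB" "C = eval.insertion x CC"
      "2 * A' = (t - 1) * A - t * B + C" "2 * B' = t * A + B + (t - 1) * C" "2 * C' = - A + (t - 1) * B + t * C"
    for x A B C A' B' C'
  proof -
    have "2 * eval.insertion x (act qU qone AA) = 2 * A'" "2 * eval.insertion x (act qU qone BB) = 2 * B'"
      "2 * eval.insertion x (act qU qone CC) = 2 * C'"
      unfolding that(4-6) act_left_qU eval.insertion_hom eval_tau t_def[symmetric] that(1-3)
      by simp_all
    then have "A' = eval.insertion x (act qU qone AA)" "B' = eval.insertion x (act qU qone BB)"
      "C' = eval.insertion x (act qU qone CC)"
      by simp_all
    then show ?thesis
      using ev[of x] unfolding F_def that(1-3) g_def s2_def s3_def s4_def a_def b_def c_def act_pscale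
        act_hom(1-5) eval.insertion_hom by simp
  qed
  \<comment> \<open>\<open>F\<close> has degree 6, so \<open>64 = 2 ^ 6\<close> clears the
    halves.\<close>
  have F_vals: "F 1 0 0 = 0" "F (- 1) 2 (- 2) = d2 * 84 + d4 * 16"
    "64 * F (A / 2) (B / 2) (- 1 / 2) = d2 * (A ^ 4 * B ^ 2 + B ^ 4 + A ^ 2) + d4 * (A ^ 2 * B ^ 2)" for A B
    by (simp_all add: F_def algebra_simps power2_eq_square power4_eq_xxxx)
  \<comment> \<open>At \<open>p = (1, 0, 0, 0)\<close> the forms take the values
    \<open>(1, 0, 0)\<close>, where \<open>F\<close> vanishes.\<close>
  have "F ((t - 1) / 2) (t / 2) (- 1 / 2) = F 1 0 0"
    by (rule F[where x = "\<lambda>l. if l = 0 then 1 else 0"]) (simp_all add: eval_ABC)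
  then have "d2 * (t + 6) + d4 = 0"
    using F_vals(1) F_vals(3)[of "t - 1" t] tt by algebra
  \<comment> \<open>At \<open>p = (1, 0, 1, 1)\<close> the forms take the values
    \<open>(-1, 2, -2)\<close>. The image again has third coordinate \<open>-1/2\<close>, so the
    same formula for \<open>F\<close> applies.\<close>
  moreover have "F ((- 3 * t - 1) / 2) ((4 - 3 * t) / 2) (- 1 / 2) = F (- 1) 2 (- 2)"
    by (rule F[where x = "\<lambda>l. if l = 1 then 0 else 1"]) (simp_all add: eval_ABC)
  then have "d2 * (4266 + 135 * t) + 999 * d4 = 0"
    using F_vals(2) F_vals(3)[of "- 3 * t - 1" "4 - 3 * t"] tt by algebra
  \<comment> \<open>The second equation minus 999 times the first is
    \<open>-864 * (t + 2) * d2 = 0\<close>.\<close>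
  ultimately have "(t + 2) * d2 = 0" 
    using tt by algebra
  moreover have "t + 2 \<noteq> 0"
    unfolding t_def using golden_pos
    by (metis add_pos_pos of_real_add of_real_eq_0_iff of_real_numeral less_irrefl zero_less_numeral)
  ultimately have "d2 = 0" "d4 = 0"
    using \<open>d2 * (t + 6) + d4 = 0\<close> by auto
  then show ?thesis
    unfolding f_eq by (auto intro!: poly4.span_add poly4.span_scale intro: poly4.span_base)
qed

section \<open>Homogeneity, dimension and generators\<close>

lemma homogeneous_0: "homogeneous d 0"
  by (simp add: homogeneous_def)

lemma homogeneous_add: "homogeneous d f \<Longrightarrow> homogeneous d g \<Longrightarrow> homogeneous d (f + g)"
  using keys_add[of f g] by (auto simp: homogeneous_def)

lemma homogeneous_mult:
  assumes "homogeneous d f" "homogeneous e g"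
  shows "homogeneous (d + e) (f * g)"
  unfolding homogeneous_def
proof
  fix m assume "m \<in> Poly_Mapping.keys (f * g)"
  then obtain a b where "m = a + b" "a \<in> Poly_Mapping.keys f" "b \<in> Poly_Mapping.keys g"
    using keys_mult[of f g] by blast
  then show "(\<Sum>l\<in>UNIV. Poly_Mapping.lookup m l) = d + e"
    using assms by (simp add: homogeneous_def lookup_add sum.distrib)
qed

lemma homogeneous_Const: "homogeneous 0 (Const c)"
  by (simp add: homogeneous_def Const_def)

lemma homogeneous_scale: "homogeneous d f \<Longrightarrow> homogeneous d (Const c * f)"
  using homogeneous_mult[OF homogeneous_Const] by simp

lemma homogeneous_minus: "homogeneous d f \<Longrightarrow> homogeneous d (- f)"
  using homogeneous_scale[of d f "- 1"] by (simp add: Const_minus)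

lemma homogeneous_diff: "homogeneous d f \<Longrightarrow> homogeneous d g \<Longrightarrow> homogeneous d (f - g)"
  using homogeneous_add[of d f "- g"] homogeneous_minus by simp

lemma homogeneous_X: "homogeneous 1 (X l)"
  by (simp add: homogeneous_def X_def sum_4_from_0 lookup_single when_def)
    (metis UNIV_4_from_0 UNIV_I empty_iff insert_iff)

lemma homogeneous_power: "homogeneous d f \<Longrightarrow> homogeneous (n * d) (f ^ n)"
proof (induction n)
  case 0
  then show ?case
    using homogeneous_Const[of 1] by simp
qed (simp add: homogeneous_mult)

lemma homogeneous_numeral: "homogeneous d f \<Longrightarrow> homogeneous d (numeral n * f)"
  using homogeneous_scale[of d f "numeral n"] by (simp add: Const_numeral)

lemma homogeneous_quadratic:
  "homogeneous 2 (X l * X k)" "homogeneous 2 (X l ^ 2)"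
  using homogeneous_mult[OF homogeneous_X homogeneous_X, of l k] homogeneous_power[OF homogeneous_X, of 2 l]
  by (simp_all add: numeral_2_eq_2)

lemma homogeneous_ABC: "homogeneous 2 AA" "homogeneous 2 BB" "homogeneous 2 CC" "homogeneous 2 q"
  unfolding AA_def BB_def CC_def q_def
  by (intro homogeneous_add homogeneous_diff homogeneous_numeral homogeneous_quadratic)+

lemma homogeneous_q_power: "homogeneous (2 * k) (q ^ k)"
  using homogeneous_power[OF homogeneous_ABC(4), of k] by (simp add: mult.commute)

lemma homogeneous_f23: "homogeneous 4 (f2 + f3)"
proof -
  have "homogeneous 4 (X i ^ 2 * X j ^ 2)" for i j
    using homogeneous_mult[OF homogeneous_quadratic(2) homogeneous_quadratic(2), of i j] by simp
  then show ?thesis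
    unfolding f2_def f3_def by (intro homogeneous_add homogeneous_numeral)
qed

lemma homogeneous_square: "homogeneous 2 f \<Longrightarrow> homogeneous 4 (f ^ 2)"
  using homogeneous_power[of 2 f 2] by simp

lemma homogeneous_P8: "homogeneous 8 P8"
proof -
  have "homogeneous (4 + 4) P8"
    unfolding P8_eq by (intro homogeneous_mult homogeneous_diff homogeneous_add homogeneous_square homogeneous_ABC)
  then show ?thesis
    by simp
qed

lemma homogeneous_P12: "homogeneous 12 P12"
proof -
  have 1: "tau ^ 2 = Const (of_real golden ^ 2)" "(tau - 1) ^ 2 = Const ((of_real golden - 1) ^ 2)"
    by (simp_all add: tau_def Const_hom)
  have "homogeneous (4 + 4 + 4) P12"
    unfolding P12_sq_eq 1
    by (intro homogeneous_mult homogeneous_diff homogeneous_scale homogeneous_square homogeneous_ABC)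
  then show ?thesis
    by simp
qed

lemma subspace_invariants: "poly4.subspace (invariants G d)"
  by (auto simp: poly4.subspace_def invariants_def homogeneous_0 homogeneous_add
      lin_subst_eq_insertion subst.insertion_hom)
   (simp_all add: pscale_def homogeneous_scale)

text \<open>The point \<open>(1, 0, \<i>, 0)\<close> is a zero of \<open>q\<close>.\<close>

lemma dim_span_q_power:
  assumes "eval.insertion (\<lambda>l. if l = 0 then 1 else if l = 2 then \<i> else 0) f \<noteq> 0" and "k > 0"
  shows "poly4.dim (poly4.span {q ^ k, f}) = 2"
proof -
  let ?x = "\<lambda>l::4. if l = 0 then 1 else if l = 2 then \<i> else 0 :: complex"
  have x: "eval.insertion ?x (q ^ k) = 0"
    using \<open>k > 0\<close> by (simp add: q_def eval.insertion_hom)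
  have "eval.insertion (\<lambda>l. if l = 0 then 1 else 0) (q ^ k) = 1"
    by (simp add: q_def eval.insertion_hom)
  then have "q ^ k \<noteq> 0"
    by (metis eval.insertion_0 zero_neq_one)
  moreover have "f \<notin> poly4.span {q ^ k}"
    using assms(1) x by (auto simp: poly4.span_singleton eval.insertion_hom)
  ultimately have "poly4.independent {f, q ^ k}" "f \<noteq> q ^ k"
    by (auto simp: poly4.independent_insert intro: poly4.span_base)
  then show ?thesis
    using poly4.dim_span_eq_card_independent[of "{f, q ^ k}"] by (simp add: insert_commute)
qed

text \<open>Nonvanishing of \<open>f\<close> at a zero of \<open>q\<close> gives independence, so
  each family needs only two memberships, a spanning argument and one value.\<close>

lemma dim_2_and_eq_span:
  assumes "poly4.subspace V" "q ^ k \<in> V" "f \<in> V" "\<And>g. g \<in> V \<Longrightarrow> g \<in> poly4.span {q ^ k, f}"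
    and "eval.insertion (\<lambda>l. if l = 0 then 1 else if l = 2 then \<i> else 0) f \<noteq> 0" "k > 0"
  shows "poly4.dim V = 2 \<and> V = poly4.span {q ^ k, f}"
proof -
  have "V = poly4.span {q ^ k, f}"
    using assms(1-4) poly4.span_minimal[of "{q ^ k, f}" V] by blast
  then show ?thesis
    using dim_span_q_power[OF assms(5,6)] by (simp only: simp_thms)
qed

section \<open>Invariants of the four families of groups\<close>

lemma norm_qi: "norm qi = 1" and norm_qS: "norm qS = 1"
  by (rule norm_eq_1; simp add: qi_def qS_def power2_eq_square)+

lemma generators_carrier:
  "{qj, qR n} \<subseteq> carrier unit_quats" "{qi, qS} \<subseteq> carrier unit_quats"
  "{qi, qR 4, qS} \<subseteq> carrier unit_quats" "{qi, qS, qU} \<subseteq> carrier unit_quats"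
  by (simp_all add: unit_quats_def norm_qj norm_qi norm_qS norm_qU)

lemma act_q_power:
  assumes "norm g = 1"
  shows "act g qone (q ^ k) = q ^ k" "act qone g (q ^ k) = q ^ k"
  by (simp_all add: act_hom act_left_q act_right_q assms)

text \<open>For even \<open>n\<close> the power of \<open>qR n\<close> with exponent
  \<open>n div 2\<close> has angle \<open>pi / 2\<close>, hence is \<open>qi\<close>.\<close>

lemma fixed_qi_of_fixed_qR:
  assumes "act (qR n) qone f = f" "even n" "n > 0"
  shows "act qi qone f = f"
proof -
  have "act (quat (cos (real k * (pi / n))) (sin (real k * (pi / n))) 0 0) qone f = f" for k
  proof (induction k)
    case (Suc k)
    let ?r = "\<lambda>k. quat (cos (real k * (pi / n))) (sin (real k * (pi / n))) 0 0"
    have "?r (Suc k) = ?r k \<star> qR n"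
      unfolding quat_eq_iff qmult_def qR_def quat_nth of_nat_Suc distrib_right cos_add sin_add
      by (simp add: algebra_simps)
    then show ?case
      using Suc assms(1) by (metis act_comp qmult_one(1))
  qed simp
  from this[of "n div 2"] show ?thesis
    using assms(2,3) by (simp add: real_of_nat_div qi_def)
qed

text \<open>Conjugating \<open>qi\<close> by \<open>qS\<close> gives \<open>-j\<close>, and the cube
  of \<open>-j\<close> is \<open>j\<close>.\<close>

lemma fixed_qj_of_fixed_qi_qS:
  assumes "act qi qone f = f" "act qS qone f = f"
  shows "act qj qone f = f"
proof -
  let ?j = "quat 0 0 (- 1) 0"
  have *: "act h qone (act g qone f) = act (g \<star> h) qone f" for g h
    by (simp add: act_comp)
  have "qi \<star> qS = qS \<star> ?j"
    by (simp add: quat_eq_iff qmult_def qi_def qS_def)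
  then have "act ?j qone f = f"
    using *[of ?j qS] *[of qS qi] assms by simp
  then have "act (?j \<star> (?j \<star> ?j)) qone f = f"
    using *[of "?j \<star> ?j" ?j] *[of ?j ?j] by simp
  moreover have "?j \<star> (?j \<star> ?j) = qj"
    by (simp add: quat_eq_iff qmult_def qj_def)
  ultimately show ?thesis
    by simp
qed

lemma invariants_dihedral_dihedral:
  assumes "even n" "n \<ge> 4" "m \<ge> 4"
  shows "poly4.dim (invariants (so4_image (bin_dihedral n) (bin_dihedral m)) 4) = 2 \<and>
    invariants (so4_image (bin_dihedral n) (bin_dihedral m)) 4 = poly4.span {q ^ 2, f2 + f3}"
proof (rule dim_2_and_eq_span[OF subspace_invariants])
  note inv = invariants_generate[OF generators_carrier(1) generators_carrier(1), folded bin_dihedral_def]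
  show "q ^ 2 \<in> invariants (so4_image (bin_dihedral n) (bin_dihedral m)) 4"
    unfolding inv using homogeneous_q_power[of 2] by (simp add: act_q_power norm_qj)
  \<comment> \<open>In this form invariance is visible: all generators fix \<open>q\<close> and send
    \<open>AA\<close> to itself or its negative.\<close>
  have eq: "f2 + f3 = pscale (1/2) (q ^ 2 - AA ^ 2)"
    using q_sq f23_eq Const_half unfolding pscale_def by algebra
  show "f2 + f3 \<in> invariants (so4_image (bin_dihedral n) (bin_dihedral m)) 4"
    unfolding inv using homogeneous_f23
    by (simp add: eq act_left_q act_right_q norm_qj act_pscale act_hom act_left_qj act_right_qj act_left_qR act_right_qR)
  show "eval.insertion (\<lambda>l. if l = 0 then 1 else if l = 2 then \<i> else 0) (f2 + f3) \<noteq> 0"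
    by (simp add: f2_def f3_def eval.insertion_hom)
  fix f assume "f \<in> invariants (so4_image (bin_dihedral n) (bin_dihedral m)) 4"
  then have f: "homogeneous (2 * 2) f" "act qj qone f = f" "act (qR n) qone f = f" "act qone qj f = f"
    "act qone (qR m) f = f"
    by (simp_all add: inv)
  have "f \<in> poly4.span (prods {AA, BB, CC} 2)"
    using assms by (intro right_dihedral_invariants[OF f(1,5,4)]) auto
  moreover have "act qi qone f = f"
    using f(3) assms by (intro fixed_qi_of_fixed_qR) auto
  ultimately have "f \<in> poly4.span (prods {AA ^ 2, BB ^ 2, CC ^ 2} (2 div 2))"
    by (intro even_left_invariants f) auto
  then show "f \<in> poly4.span {q ^ 2, f2 + f3}"
    using assms by (intro left_dihedral_degree_4[OF _ f(3)]) auto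
qed simp

lemma even_span_right_dihedral:
  assumes "homogeneous (2 * k) f" "act qone qj f = f" "act qone (qR n) f = f" "even k" "k < n"
    "act qi qone f = f" "act qS qone f = f"
  shows "f \<in> poly4.span (prods {AA ^ 2, BB ^ 2, CC ^ 2} (k div 2))"
  using assms by (intro even_left_invariants right_dihedral_invariants fixed_qj_of_fixed_qi_qS)

lemma act_P8:
  "act qone qj P8 = P8" "act qone (qR n) P8 = P8" "act qi qone P8 = P8" "act qS qone P8 = P8"
  "act (qR 4) qone P8 = P8"
proof -
  show "act qone qj P8 = P8" "act qone (qR n) P8 = P8" "act qi qone P8 = P8"
    unfolding P8_eq act_hom act_right_qj act_right_qR act_left_qi by algebra+
  show "act qS qone P8 = P8"
    unfolding P8_eq act_hom act_left_qS by algebra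
  \<comment> \<open>The rotation is a quarter turn, which exchanges \<open>BB\<close> and
    \<open>CC\<close> up to sign.\<close>
  have "2 * (pi / real 4) = pi / 2"
    by simp
  then show "act (qR 4) qone P8 = P8"
    unfolding P8_eq act_hom act_left_qR by simp algebra
qed

lemma act_right_P12: "act qone qj P12 = P12" "act qone (qR n) P12 = P12"
  by (simp_all add: P12_sq_eq act_hom act_right_qj act_right_qR)

lemma invariants_tetrahedral_dihedral:
  assumes "n \<ge> 6"
  shows "poly4.dim (invariants (so4_image bin_tetrahedral (bin_dihedral n)) 8) = 2 \<and>
    invariants (so4_image bin_tetrahedral (bin_dihedral n)) 8 = poly4.span {q ^ 4, P8}"
proof (rule dim_2_and_eq_span[OF subspace_invariants])
  note inv = invariants_generate[OF generators_carrier(2) generators_carrier(1),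
      folded bin_dihedral_def bin_tetrahedral_def]
  show "q ^ 4 \<in> invariants (so4_image bin_tetrahedral (bin_dihedral n)) 8"
    unfolding inv using homogeneous_q_power[of 4] by (simp add: act_q_power norm_qj norm_qi norm_qS)
  show "P8 \<in> invariants (so4_image bin_tetrahedral (bin_dihedral n)) 8"
    unfolding inv using homogeneous_P8 by (simp add: act_P8)
  \<comment> \<open>At this point \<open>AA\<close>, \<open>BB\<close>, \<open>CC\<close> are
    \<open>2\<close>, \<open>0\<close>, \<open>-2 i\<close>, and \<open>P8\<close> has the value
    64.\<close>
  show "eval.insertion (\<lambda>l. if l = 0 then 1 else if l = 2 then \<i> else 0) P8 \<noteq> 0"
    by (simp add: P8_eq eval.insertion_hom eval_ABC power_mult_distrib)
  fix f assume "f \<in> invariants (so4_image bin_tetrahedral (bin_dihedral n)) 8"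
  then have f: "homogeneous (2 * 4) f" "act qone qj f = f" "act qone (qR n) f = f" "act qi qone f = f" "act qS qone f = f"
    by (simp_all add: inv)
  have "f \<in> poly4.span (prods {AA ^ 2, BB ^ 2, CC ^ 2} (4 div 2))"
    using assms by (intro even_span_right_dihedral[OF f(1-3) _ _ f(4,5)]) auto
  then show "f \<in> poly4.span {q ^ 4, P8}"
    using left_tetrahedral_degree_8 f(5) by simp
qed simp

text \<open>The octahedral generators include the tetrahedral ones, so the invariants lie between
  the span of \<open>q ^ 4\<close>, \<open>P8\<close> and the tetrahedral invariants, which
  coincide.\<close>

lemma invariants_octahedral_dihedral:
  assumes "n \<ge> 6"
  shows "poly4.dim (invariants (so4_image bin_octahedral (bin_dihedral n)) 8) = 2 \<and>
    invariants (so4_image bin_octahedral (bin_dihedral n)) 8 = poly4.span {q ^ 4, P8}"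
proof -
  note inv = invariants_generate[OF generators_carrier(3) generators_carrier(1),
      folded bin_dihedral_def bin_octahedral_def]
    invariants_generate[OF generators_carrier(2) generators_carrier(1),
      folded bin_dihedral_def bin_tetrahedral_def]
  have "q ^ 4 \<in> invariants (so4_image bin_octahedral (bin_dihedral n)) 8"
    unfolding inv using homogeneous_q_power[of 4] by (simp add: act_q_power norm_qj norm_qi norm_qS)
  moreover have "P8 \<in> invariants (so4_image bin_octahedral (bin_dihedral n)) 8"
    unfolding inv using homogeneous_P8 by (simp add: act_P8)
  ultimately have "poly4.span {q ^ 4, P8} \<subseteq> invariants (so4_image bin_octahedral (bin_dihedral n)) 8"
    by (intro poly4.span_minimal subspace_invariants) auto
  moreover have "invariants (so4_image bin_octahedral (bin_dihedral n)) 8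
      \<subseteq> invariants (so4_image bin_tetrahedral (bin_dihedral n)) 8"
    by (auto simp: inv)
  ultimately show ?thesis
    using invariants_tetrahedral_dihedral[OF assms] by (metis subset_antisym)
qed

lemma invariants_icosahedral_dihedral:
  assumes "n \<ge> 8"
  shows "poly4.dim (invariants (so4_image bin_icosahedral (bin_dihedral n)) 12) = 2 \<and>
    invariants (so4_image bin_icosahedral (bin_dihedral n)) 12 = poly4.span {q ^ 6, P12}"
proof (rule dim_2_and_eq_span[OF subspace_invariants])
  note inv = invariants_generate[OF generators_carrier(4) generators_carrier(1),
      folded bin_dihedral_def bin_icosahedral_def]
  show "q ^ 6 \<in> invariants (so4_image bin_icosahedral (bin_dihedral n)) 12"
    unfolding inv using homogeneous_q_power[of 6] by (simp add: act_q_power norm_qj norm_qi norm_qS norm_qU)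
  show "P12 \<in> invariants (so4_image bin_icosahedral (bin_dihedral n)) 12"
    unfolding inv using homogeneous_P12 by (simp add: act_right_P12 act_qi_P12 act_qS_P12 act_qU_P12)
  \<comment> \<open>At the zero \<open>(1, 0, i, 0)\<close> of \<open>q\<close> the value of
    \<open>P12\<close> is \<open>-64\<close> times this number.\<close>
  have "1 + (golden - 1)\<^sup>2 \<noteq> 0"
    by (smt (verit) zero_le_power2)
  then have "complex_of_real (1 + (golden - 1)\<^sup>2) \<noteq> 0"
    by (simp only: of_real_eq_0_iff not_False_eq_True)
  then show "eval.insertion (\<lambda>l. if l = 0 then 1 else if l = 2 then \<i> else 0) P12 \<noteq> 0"
    by (simp add: P12_sq_eq eval.insertion_hom eval_ABC eval_tau power_mult_distrib add_eq_0_iff)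
  fix f assume "f \<in> invariants (so4_image bin_icosahedral (bin_dihedral n)) 12"
  then have f: "homogeneous (2 * 6) f" "act qone qj f = f" "act qone (qR n) f = f" "act qi qone f = f" "act qS qone f = f"
      "act qU qone f = f"
    by (simp_all add: inv)
  have "f \<in> poly4.span (prods {AA ^ 2, BB ^ 2, CC ^ 2} (6 div 2))"
    using assms by (intro even_span_right_dihedral[OF f(1-3) _ _ f(4,5)]) auto
  then show "f \<in> poly4.span {q ^ 6, P12}"
    using left_icosahedral_degree_12 f(5,6) by simp
qed simp

theorem mainTheorem3:
  shows
   "(\<forall>n m :: nat. even n \<longrightarrow> even m \<longrightarrow> n \<ge> 4 \<longrightarrow> m \<ge> 4 \<longrightarrow>
       (let V = invariants (so4_image (bin_dihedral n) (bin_dihedral m)) 4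
        in poly4.dim V = 2 \<and> V = poly4.span {q ^ 2, f2 + f3}))
    \<and>
    (\<forall>n :: nat. even n \<longrightarrow> n \<ge> 6 \<longrightarrow>
       (let V = invariants (so4_image bin_tetrahedral (bin_dihedral n)) 8;
            W = invariants (so4_image bin_octahedral (bin_dihedral n)) 8
        in poly4.dim V = 2 \<and> V = poly4.span {q ^ 4, P8} \<and>
           poly4.dim W = 2 \<and> W = poly4.span {q ^ 4, P8}))
    \<and>
    (\<forall>n :: nat. even n \<longrightarrow> n \<ge> 8 \<longrightarrow>
       (let V = invariants (so4_image bin_icosahedral (bin_dihedral n)) 12
        in poly4.dim V = 2 \<and> V = poly4.span {q ^ 6, P12}))"
  unfolding Let_def
  by (intro conjI allI impI; elim invariants_dihedral_dihedral[THEN conjunct1]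
      invariants_dihedral_dihedral[THEN conjunct2] invariants_tetrahedral_dihedral[THEN conjunct1]
      invariants_tetrahedral_dihedral[THEN conjunct2] invariants_octahedral_dihedral[THEN conjunct1]
      invariants_octahedral_dihedral[THEN conjunct2] invariants_icosahedral_dihedral[THEN conjunct1]
      invariants_icosahedral_dihedral[THEN conjunct2])

end
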